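(* Fix $0<\varepsilon<1/2$. There exists an $O(n^4)$-time TSP-domination algorithm which has domination ratio at least $1-6n^{-2\varepsilon}$ for every $(n,d,\varepsilon)$-sparse instance of TSP with $n\ge225$.
   Context: $K_n=(V_n,E_n)$ is the complete graph on $n$ vertices, $\mathcal H_n$ its set of (undirected) Hamilton cycles; $w(G)=\sum_{e\in E(G)}w(e)$; a $\{0,1\}$-instance has $w:E_n\to\{0,1\}$. A TSP-domination algorithm, given $(n,w)$, outputs a Hamilton cycle $H^*$; it has domination ratio at least $\rho$ for $(n,w)$ if $\mathbb{P}(w(H)<w(H^* ))\le1-\rho$ for $H$ uniform in $\mathcal H_n$. For $0<\varepsilon<1/2$, a $\{0,1\}$-instance $(n,w)$ is $(n,d,\varepsilon)$-sparse if $w(K_n)=d\binom n2$ with $d\le\frac14n^{-1/2-\varepsilon}$. *)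

theory Defs
  imports Complex_Main
begin

definition edges_Kn :: "nat \<Rightarrow> nat set set" where
  "edges_Kn n = {e. \<exists>i j. i < n \<and> j < n \<and> i \<noteq> j \<and> e = {i, j}}"

definition cycle_edges :: "nat list \<Rightarrow> nat set set" where
  "cycle_edges xs = {{xs ! i, xs ! ((i + 1) mod length xs)} | i. i < length xs}"

definition is_ham_order :: "nat \<Rightarrow> nat list \<Rightarrow> bool" where
  "is_ham_order n xs \<longleftrightarrow> distinct xs \<and> set xs = {0..<n}"

definition ham_cycles :: "nat \<Rightarrow> nat set set set" where
  "ham_cycles n = cycle_edges ` {xs. is_ham_order n xs}"

definition wt :: "(nat set \<Rightarrow> nat) \<Rightarrow> nat set set \<Rightarrow> nat" where
  "wt w G = (\<Sum>e\<in>G. w e)"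

definition zero_one_instance :: "nat \<Rightarrow> (nat set \<Rightarrow> nat) \<Rightarrow> bool" where
  "zero_one_instance n w \<longleftrightarrow> (\<forall>e\<in>edges_Kn n. w e \<in> {0, 1})"

definition sparse_instance :: "nat \<Rightarrow> real \<Rightarrow> real \<Rightarrow> (nat set \<Rightarrow> nat) \<Rightarrow> bool" where
  "sparse_instance n d \<epsilon> w \<longleftrightarrow> zero_one_instance n w \<and>
     real (wt w (edges_Kn n)) = d * real (n choose 2) \<and>
     d \<le> (1/4) * real n powr (- 1/2 - \<epsilon>)"

definition domination_ratio_ge :: "nat \<Rightarrow> (nat set \<Rightarrow> nat) \<Rightarrow> nat set set \<Rightarrow> real \<Rightarrow> bool" where
  "domination_ratio_ge n w Hs \<rho> \<longleftrightarrow>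
     real (card {H \<in> ham_cycles n. wt w H < wt w Hs}) / real (card (ham_cycles n)) \<le> 1 - \<rho>"

text \<open>Registers r and memory m, both nat-valued; unit cost per instruction;
  arithmetic is addition and truncated subtraction; indirect addressing.\<close>
datatype instr =
    LoadC nat nat
  | Add nat nat nat
  | Sub nat nat nat
  | Load nat nat
  | Store nat nat
  | Jz nat nat

type_synonym config = "nat \<times> (nat \<Rightarrow> nat) \<times> (nat \<Rightarrow> nat)"

fun exec :: "instr \<Rightarrow> config \<Rightarrow> config" where
  "exec (LoadC a k) (pc, r, m) = (pc + 1, r(a := k), m)"
| "exec (Add a b c) (pc, r, m) = (pc + 1, r(a := r b + r c), m)"
| "exec (Sub a b c) (pc, r, m) = (pc + 1, r(a := r b - r c), m)"
| "exec (Load a b) (pc, r, m) = (pc + 1, r(a := m (r b)), m)"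
| "exec (Store a b) (pc, r, m) = (pc + 1, r, m(r a := r b))"
| "exec (Jz a l) (pc, r, m) = (if r a = 0 then l else pc + 1, r, m)"

definition ram_halted :: "instr list \<Rightarrow> config \<Rightarrow> bool" where
  "ram_halted P c \<longleftrightarrow> fst c \<ge> length P"

definition ram_step :: "instr list \<Rightarrow> config \<Rightarrow> config" where
  "ram_step P c = (if ram_halted P c then c else exec (P ! fst c) c)"

text \<open>Input encoding: m 0 = n, m (1 + i*n + j) = w {i,j} for i \<noteq> j < n, all else 0.\<close>
definition ram_init :: "nat \<Rightarrow> (nat set \<Rightarrow> nat) \<Rightarrow> config" where
  "ram_init n w = (0, (\<lambda>_. 0),
     (\<lambda>a. if a = 0 then n
          else if a - 1 < n * n \<and> (a - 1) div n \<noteq> (a - 1) mod n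
               then w {(a - 1) div n, (a - 1) mod n} else 0))"

text \<open>Output: the cyclic vertex order stored in m 0, ..., m (n-1).\<close>
definition ram_output :: "nat \<Rightarrow> config \<Rightarrow> nat list" where
  "ram_output n c = map (snd (snd c)) [0..<n]"

end

theory Submission
  imports Defs "HOL-Combinatorics.Transposition"
begin

text \<open>
  The algorithm is 2-opt local search, not for the weights \<open>w\<close> themselves but for the edge costs
  \<open>w {u, v} * (deg u + deg v)\<close>, where \<open>deg\<close> counts the weight-1 edges at a vertex. A tour costs at most
  \<open>2n\<^sup>2\<close>, every improvement lowers the cost by at least one, and an improving pair is found in
  time \<open>O(n\<^sup>2)\<close>; this gives \<open>O(n\<^sup>4)\<close>.

  Call a vertex heavy if its degree is at least \<open>(n - 1)/2\<close>; let \<open>h\<close> be the number of heavy vertices.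
  Call a heavy vertex saturated if it has at most \<open>h\<close> weight-0 edges. In a 2-optimal tour every weight-1
  edge touches a saturated vertex. Indeed, a heavy unsaturated vertex \<open>x\<close> on such an edge has a weight-0
  neighbour whose successor on the tour is not heavy, and the corresponding 2-opt move is profitable
  since the degrees enter the cost; if neither end is heavy, the two degrees sum to less than \<open>n - 1\<close> and
  some 2-opt move inserts two weight-0 edges. Hence the tour has weight at most \<open>2|S|\<close>, where \<open>S\<close> is the
  set of saturated vertices.

  Conversely a Hamilton cycle has weight at least \<open>2|S|\<close> if it contains no weight-0 edge at \<open>S\<close> and no
  edge inside \<open>S\<close>. There are at most \<open>2h\<^sup>2\<close> such exceptional edges, each lies on a random Hamilton
  cycle with probability \<open>2/(n - 1)\<close>, and sparsity gives \<open>2h \<le> n\<^bsup>1/2 - \<epsilon>\<^esup>\<close>.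
\<close>

section \<open>Structured programs for the RAM\<close>

type_synonym store = "(nat \<Rightarrow> nat) \<times> (nat \<Rightarrow> nat)"

datatype com =
    Blk "instr list"
  | Seq com com
  | If nat com
  | Loop "instr list" nat com

fun eff :: "instr \<Rightarrow> store \<Rightarrow> store" where
  "eff i s = snd (exec i (0, s))"

fun blk :: "instr list \<Rightarrow> store \<Rightarrow> store" where
  "blk [] s = s"
| "blk (i # is) s = blk is (eff i s)"

text \<open>The number counts the machine steps of the compiled code exactly: a test by
  \<open>Jz\<close> costs one step, and each completed round of a loop costs one more for the jump
  back.\<close>

inductive big :: "com \<Rightarrow> store \<Rightarrow> nat \<Rightarrow> store \<Rightarrow> bool" where
  Blk: "big (Blk is) s (length is) (blk is s)"
| Seq: "big c1 s t1 s1 \<Longrightarrow> big c2 s1 t2 s2 \<Longrightarrow> big (Seq c1 c2) s (t1 + t2) s2"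
| IfF: "fst s a = 0 \<Longrightarrow> big (If a c) s 1 s"
| IfT: "fst s a \<noteq> 0 \<Longrightarrow> big c s t s' \<Longrightarrow> big (If a c) s (1 + t) s'"
| LoopF: "fst (blk is s) a = 0 \<Longrightarrow> big (Loop is a c) s (length is + 1) (blk is s)"
| LoopT: "fst (blk is s) a \<noteq> 0 \<Longrightarrow> big c (blk is s) t1 s1 \<Longrightarrow> big (Loop is a c) s1 t2 s2
    \<Longrightarrow> big (Loop is a c) s (length is + 1 + t1 + 1 + t2) s2"

text \<open>Excludes jumps, so that control falls through, and writes to register 0, which has to
  stay 0.\<close>

fun simple :: "instr \<Rightarrow> bool" where
  "simple (LoadC a k) = (a \<noteq> 0)"
| "simple (Add a b c) = (a \<noteq> 0)"
| "simple (Sub a b c) = (a \<noteq> 0)"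
| "simple (Load a b) = (a \<noteq> 0)"
| "simple (Store a b) = True"
| "simple (Jz a l) = False"

fun wf_com :: "com \<Rightarrow> bool" where
  "wf_com (Blk is) = (\<forall>i\<in>set is. simple i)"
| "wf_com (Seq c1 c2) = (wf_com c1 \<and> wf_com c2)"
| "wf_com (If a c) = wf_com c"
| "wf_com (Loop is a c) = ((\<forall>i\<in>set is. simple i) \<and> wf_com c)"

text \<open>Register 0 is never written, so \<open>Jz 0\<close> is an unconditional jump.\<close>
fun compile :: "nat \<Rightarrow> com \<Rightarrow> instr list" where
  "compile l (Blk is) = is"
| "compile l (Seq c1 c2) = compile l c1 @ compile (l + length (compile l c1)) c2"
| "compile l (If a c) = Jz a (l + 1 + length (compile (l + 1) c)) # compile (l + 1) c"
| "compile l (Loop is a c) = is @ [Jz a (l + length is + length (compile (l + length is + 1) c) + 2)]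
     @ compile (l + length is + 1) c @ [Jz 0 l]"

text \<open>Jump targets are absolute, so a fragment is correct only at the address for which it was
  compiled.\<close>

definition code_at :: "instr list \<Rightarrow> nat \<Rightarrow> instr list \<Rightarrow> bool" where
  "code_at P l is \<longleftrightarrow> (\<forall>k<length is. l + k < length P \<and> P ! (l + k) = is ! k)"

lemma code_at_Nil [simp]: "code_at P l []"
  by (simp add: code_at_def)

lemma code_at_Cons [simp]:
  "code_at P l (i # is) \<longleftrightarrow> l < length P \<and> P ! l = i \<and> code_at P (l + 1) is"
  by (auto simp: code_at_def less_Suc_eq_0_disj nth_Cons split: nat.splits)

lemma code_at_append [simp]:
  "code_at P l (is @ js) \<longleftrightarrow> code_at P l is \<and> code_at P (l + length is) js"
  by (induction "is" arbitrary: l) auto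

lemma simple_exec:
  assumes "simple i"
  shows "exec i (pc, s) = (pc + 1, eff i s)" "fst (eff i s) 0 = fst s 0"
  using assms by (cases i; cases s; simp)+

lemma ram_step_code: "pc < length P \<Longrightarrow> ram_step P (pc, s) = exec (P ! pc) (pc, s)"
  by (simp add: ram_step_def ram_halted_def)

lemma funpow_add_apply: "(f ^^ (a + b)) x = (f ^^ b) ((f ^^ a) x)"
  by (metis add.commute comp_apply funpow_add)

lemma blk_run:
  assumes "code_at P l is" "\<forall>i\<in>set is. simple i"
  shows "(ram_step P ^^ length is) (l, s) = (l + length is, blk is s) \<and> fst (blk is s) 0 = fst s 0"
  using assms
proof (induction "is" arbitrary: l s)
  case (Cons i "is")
  have "ram_step P (l, s) = (l + 1, eff i s)"
    using Cons.prems by (simp add: ram_step_code simple_exec del: eff.simps)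
  with Cons.IH[of "l + 1" "eff i s"] Cons.prems show ?case
    by (simp add: funpow_swap1 simple_exec del: eff.simps)
qed simp

text \<open>Induction on the execution, with the start address generalised because subcommands sit
  at shifted addresses. That register 0 still holds 0 is carried along; it makes the closing jump of
  a loop unconditional.\<close>

theorem compile_correct:
  assumes "big c s t s'" "wf_com c" "code_at P l (compile l c)" "fst s 0 = 0"
  shows "(ram_step P ^^ t) (l, s) = (l + length (compile l c), s') \<and> fst s' 0 = 0"
  using assms
proof (induction arbitrary: l rule: big.induct)
  case (Blk "is" s)
  then show ?case using blk_run by simp
next
  case (Seq c1 s t1 s1 c2 t2 s2)
  then show ?case
    using Seq.IH(1)[of l] Seq.IH(2)[of "l + length (compile l c1)"]
    by (simp add: funpow_add_apply add.assoc)
next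
  case (IfF s a c)
  then show ?case by (cases s) (simp add: ram_step_code)
next
  case (IfT s a c t s')
  have "ram_step P (l, s) = (l + 1, s)"
    using IfT by (cases s) (simp add: ram_step_code)
  then show ?case using IfT.IH[of "l + 1"] IfT.prems by (simp add: funpow_swap1 add.assoc)
next
  case (LoopF "is" s a c)
  have "(ram_step P ^^ length is) (l, s) = (l + length is, blk is s) \<and> fst (blk is s) 0 = 0"
    using blk_run[of P l "is" s] LoopF.prems by simp
  then show ?case using LoopF by (cases "blk is s") (simp add: ram_step_code)
next
  case (LoopT "is" s a c t1 s1 t2 s2)
  let ?l = "l + length is + 1"
  have 1: "(ram_step P ^^ length is) (l, s) = (l + length is, blk is s)" "fst (blk is s) 0 = 0"
    using blk_run[of P l "is" s] LoopT.prems by simp_all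
  have 2: "ram_step P (l + length is, blk is s) = (?l, blk is s)"
    using LoopT by (cases "blk is s") (simp add: ram_step_code)
  have 3: "(ram_step P ^^ t1) (?l, blk is s) = (?l + length (compile ?l c), s1)" "fst s1 0 = 0"
    using LoopT.IH(1)[of ?l] LoopT.prems 1 by simp_all
  have 4: "ram_step P (?l + length (compile ?l c), s1) = (l, s1)"
    using LoopT.prems 3 by (cases s1) (simp add: ram_step_code add.assoc)
  show ?case
    using LoopT.IH(2)[of l] LoopT.prems 1 2 3 4
    by (simp only: funpow_add_apply) (simp add: funpow_add_apply)
qed

section \<open>Total correctness with time bounds\<close>

definition runs :: "com \<Rightarrow> store \<Rightarrow> nat \<Rightarrow> (store \<Rightarrow> bool) \<Rightarrow> bool" where
  "runs c s B Q \<longleftrightarrow> (\<exists>t s'. big c s t s' \<and> t \<le> B \<and> Q s')"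

lemma runs_Blk: "Q (blk is s) \<Longrightarrow> length is \<le> B \<Longrightarrow> runs (Blk is) s B Q"
  unfolding runs_def using big.Blk by blast

lemma runs_Seq:
  "runs c1 s B1 Q1 \<Longrightarrow> (\<And>s1. Q1 s1 \<Longrightarrow> runs c2 s1 B2 Q) \<Longrightarrow> B1 + B2 \<le> B
    \<Longrightarrow> runs (Seq c1 c2) s B Q"
  unfolding runs_def by (meson big.Seq add_mono order_trans)

lemma runs_If:
  "(fst s a = 0 \<Longrightarrow> Q s) \<Longrightarrow> (fst s a \<noteq> 0 \<Longrightarrow> runs c s B Q) \<Longrightarrow> B + 1 \<le> B'
    \<Longrightarrow> runs (If a c) s B' Q"
  unfolding runs_def
  by (cases "fst s a = 0", metis big.IfF le_add2 order_trans,
      metis big.IfT add.commute add_le_mono1 order_trans)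

lemma runs_mono: "runs c s B Q \<Longrightarrow> (\<And>s'. Q s' \<Longrightarrow> Q' s') \<Longrightarrow> B \<le> B' \<Longrightarrow> runs c s B' Q'"
  unfolding runs_def by (meson order_trans)

text \<open>The index \<open>k\<close> of the invariant is a variant, so at most \<open>k\<close>
  rounds occur. Each costs the test block, two jumps and the body bound \<open>B\<close>; the last,
  failing test costs \<open>length is + 1\<close>. The invariant refers to the store before the test
  block.\<close>

lemma runs_Loop:
  assumes "I k s"
    and exit: "\<And>k s. I k s \<Longrightarrow> fst (blk is s) a = 0 \<Longrightarrow> Q (blk is s)"
    and body: "\<And>k s. I k s \<Longrightarrow> fst (blk is s) a \<noteq> 0 \<Longrightarrow> runs c (blk is s) B (\<lambda>s'. \<exists>k'<k. I k' s')"
    and "k * (length is + 2 + B) + length is + 1 \<le> B'"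
  shows "runs (Loop is a c) s B' Q"
proof -
  have "\<exists>t s'. big (Loop is a c) s t s' \<and> t \<le> k * (length is + 2 + B) + length is + 1 \<and> Q s'"
    using assms(1)
  proof (induction k arbitrary: s rule: less_induct)
    case (less k)
    show ?case
    proof (cases "fst (blk is s) a = 0")
      case True
      then show ?thesis
        using exit[OF less.prems] big.LoopF[OF True] by fastforce
    next
      case False
      from body[OF less.prems False] obtain t1 s1 k' where
        1: "big c (blk is s) t1 s1" "t1 \<le> B" "k' < k" "I k' s1"
        unfolding runs_def by blast
      from less.IH[OF 1(3,4)] obtain t2 s2 where
        2: "big (Loop is a c) s1 t2 s2" "t2 \<le> k' * (length is + 2 + B) + length is + 1" "Q s2"
        by blast
      have "(k' + 1) * (length is + 2 + B) \<le> k * (length is + 2 + B)"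
        using 1(3) by (intro mult_right_mono) auto
      then have "length is + 1 + t1 + 1 + t2 \<le> k * (length is + 2 + B) + length is + 1"
        using 1(2) 2(2) by (simp add: algebra_simps)
      then show ?thesis using big.LoopT[OF False 1(1) 2(1)] 2(3) by blast
    qed
  qed
  then show ?thesis unfolding runs_def using assms(4) order_trans by blast
qed

section \<open>2-optimal tours\<close>

text \<open>The diagonal is set to 0, as in the input matrix of the machine; the value of
  \<open>w\<close> at a singleton is arbitrary.\<close>

definition wm :: "(nat set \<Rightarrow> nat) \<Rightarrow> nat \<Rightarrow> nat \<Rightarrow> nat" where
  "wm w u v = (if u = v then 0 else w {u, v})"

definition deg :: "nat \<Rightarrow> (nat set \<Rightarrow> nat) \<Rightarrow> nat \<Rightarrow> nat" where
  "deg n w u = (\<Sum>v<n. wm w u v)"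

text \<open>For 0-1 weights this is the weight times the sum of the degrees, in a form that a
  machine without multiplication can evaluate.\<close>

definition ecost :: "nat \<Rightarrow> (nat set \<Rightarrow> nat) \<Rightarrow> nat \<Rightarrow> nat \<Rightarrow> nat" where
  "ecost n w u v = (if wm w u v = 0 then 0 else deg n w u + deg n w v)"

text \<open>The repeated value \<open>p n = p 0\<close> lets every edge be written
  \<open>{p k, p (Suc k)}\<close> without reduction modulo \<open>n\<close>.\<close>

definition tour :: "nat \<Rightarrow> (nat \<Rightarrow> nat) \<Rightarrow> bool" where
  "tour n p \<longleftrightarrow> bij_betw p {..<n} {..<n} \<and> p n = p 0"

definition tour_edges :: "nat \<Rightarrow> (nat \<Rightarrow> nat) \<Rightarrow> nat set set" where
  "tour_edges n p = (\<lambda>k. {p k, p (Suc k)}) ` {..<n}"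

definition tour_cost :: "nat \<Rightarrow> (nat set \<Rightarrow> nat) \<Rightarrow> (nat \<Rightarrow> nat) \<Rightarrow> nat" where
  "tour_cost n w p = (\<Sum>k<n. ecost n w (p k) (p (Suc k)))"

text \<open>The 2-opt move on the tour edges at positions \<open>i\<close> and \<open>j\<close>
  joins their two first ends and their two second ends instead.\<close>

definition improving :: "nat \<Rightarrow> (nat set \<Rightarrow> nat) \<Rightarrow> (nat \<Rightarrow> nat) \<Rightarrow> nat \<Rightarrow> nat \<Rightarrow> bool" where
  "improving n w p i j \<longleftrightarrow> ecost n w (p i) (p j) + ecost n w (p (Suc i)) (p (Suc j))
     < ecost n w (p i) (p (Suc i)) + ecost n w (p j) (p (Suc j))"

text \<open>Adjacent tour edges are included; for them the move inserts the same two edges that it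
  removes, so it is never a strict improvement.\<close>

definition two_optimal :: "nat \<Rightarrow> (nat set \<Rightarrow> nat) \<Rightarrow> (nat \<Rightarrow> nat) \<Rightarrow> bool" where
  "two_optimal n w p \<longleftrightarrow> (\<forall>i j. i < j \<and> j < n \<longrightarrow> \<not> improving n w p i j)"

definition rev_seg :: "nat \<Rightarrow> nat \<Rightarrow> (nat \<Rightarrow> nat) \<Rightarrow> nat \<Rightarrow> nat" where
  "rev_seg lo hi p k = (if lo \<le> k \<and> k \<le> hi then p (lo + hi - k) else p k)"

section \<open>Tours and Hamilton cycles\<close>

lemma wm_sym: "wm w u v = wm w v u"
  by (auto simp: wm_def insert_commute)

lemma ecost_sym: "ecost n w u v = ecost n w v u"
  by (simp add: ecost_def wm_sym[of w u v] add.commute)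

lemma tour_inj:
  assumes "tour n p" "i < n" "j < n"
  shows "p i = p j \<longleftrightarrow> i = j"
  using assms by (auto simp: tour_def bij_betw_def inj_on_def)

lemma tour_lt:
  assumes "tour n p" "i \<le> n" "0 < n"
  shows "p i < n"
  using assms bij_betwE by (cases "i = n") (fastforce simp: tour_def)+

lemma tour_Suc:
  assumes "tour n p" "k < n"
  shows "p (Suc k) = p (Suc k mod n)"
  using assms by (cases "Suc k = n") (auto simp: tour_def)

lemma bij_Suc_mod:
  assumes "0 < n"
  shows "bij_betw (\<lambda>k. Suc k mod n) {..<n} {..<n}"
proof -
  have "inj_on (\<lambda>k. Suc k mod n) {..<n}"
    by (auto simp: inj_on_def mod_Suc split: if_splits)
  moreover have "(\<lambda>k. Suc k mod n) ` {..<n} \<subseteq> {..<n}"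
    using assms by auto
  ultimately show ?thesis
    by (simp add: bij_betw_def endo_inj_surj)
qed

lemma tour_Suc_bij:
  assumes "tour n p" "0 < n"
  shows "bij_betw (\<lambda>k. p (Suc k)) {..<n} {..<n}"
proof -
  have "bij_betw (p \<circ> (\<lambda>k. Suc k mod n)) {..<n} {..<n}"
    using assms bij_Suc_mod by (intro bij_betw_trans) (auto simp: tour_def)
  then show ?thesis
    using tour_Suc[OF assms(1)] by (subst bij_betw_cong[where g="p \<circ> (\<lambda>k. Suc k mod n)"]) auto
qed

lemma tour_neq_Suc:
  assumes "tour n p" "2 \<le> n" "k < n"
  shows "p k \<noteq> p (Suc k)"
  using assms tour_Suc[OF assms(1,3)] tour_inj[OF assms(1,3), of "Suc k mod n"]
  by (auto simp: mod_Suc split: if_splits)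

lemma tour_edge_inj:
  assumes "tour n p" "3 \<le> n"
  shows "inj_on (\<lambda>k. {p k, p (Suc k)}) {..<n}"
proof (rule inj_onI)
  fix i j assume ij: "i \<in> {..<n}" "j \<in> {..<n}" "{p i, p (Suc i)} = {p j, p (Suc j)}"
  have s: "p (Suc i) = p (Suc i mod n)" "p (Suc j) = p (Suc j mod n)"
    using ij assms tour_Suc by auto
  have m: "Suc i mod n < n" "Suc j mod n < n" using assms by auto
  from ij consider "p i = p j" | "p i = p (Suc j)" "p (Suc i) = p j"
    by (auto simp: doubleton_eq_iff)
  then show "i = j"
  proof cases
    case 1 then show ?thesis using ij tour_inj[OF assms(1)] by auto
  next
    case 2
    then have "i = Suc j mod n" "Suc i mod n = j"
      using s m ij tour_inj[OF assms(1)] by auto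
    \<comment> \<open>Here two steps round the cycle lead from \<open>i\<close> back to
      \<open>i\<close>, which \<open>3 \<le> n\<close> rules out.\<close>
    then show ?thesis using assms ij by (auto simp: mod_Suc split: if_splits)
  qed
qed

lemma wt_tour:
  assumes "tour n p" "3 \<le> n"
  shows "wt w (tour_edges n p) = (\<Sum>k<n. wm w (p k) (p (Suc k)))"
proof -
  have "wt w (tour_edges n p) = (\<Sum>k<n. w {p k, p (Suc k)})"
    unfolding wt_def tour_edges_def by (simp add: sum.reindex tour_edge_inj[OF assms])
  also have "\<dots> = (\<Sum>k<n. wm w (p k) (p (Suc k)))"
    using tour_neq_Suc[OF assms(1)] assms(2) by (intro sum.cong) (auto simp: wm_def)
  finally show ?thesis .
qed

lemma is_ham_order_tour:
  assumes "tour n p"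
  shows "is_ham_order n (map p [0..<n])"
  using assms by (auto simp: tour_def is_ham_order_def bij_betw_def distinct_map atLeast0LessThan)

lemma cycle_edges_tour:
  assumes "tour n p"
  shows "cycle_edges (map p [0..<n]) = tour_edges n p"
proof -
  have "{map p [0..<n] ! i, map p [0..<n] ! ((i + 1) mod n)} = {p i, p (Suc i)}" if "i < n" for i
    using that tour_Suc[OF assms that] by (simp add: mod_less_divisor)
  then show ?thesis
    unfolding cycle_edges_def tour_edges_def length_map length_upt diff_zero by blast
qed

text \<open>Connects the vertex lists in the definition of \<open>ham_cycles\<close> with position
  functions, on which the later arguments rest.\<close>

lemma ham_cycles_tour: "ham_cycles n = tour_edges n ` {p. tour n p}"
proof (intro equalityI subsetI)
  fix H assume "H \<in> ham_cycles n"
  then obtain xs where xs: "is_ham_order n xs" "H = cycle_edges xs"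
    by (auto simp: ham_cycles_def)
  have len: "length xs = n"
    using xs(1) distinct_card[of xs] by (simp add: is_ham_order_def)
  \<comment> \<open>Periodic extension of the list supplies the closing value
    \<open>p n = p 0\<close>.\<close>
  define p where "p k = xs ! (k mod n)" for k
  have "map p [0..<n] = xs"
    using len by (auto simp: p_def intro: nth_equalityI)
  moreover have "tour n p"
  proof -
    have "bij_betw (nth xs) {..<n} {..<n}"
      by (rule bij_betw_nth) (use xs(1) len in \<open>simp_all add: is_ham_order_def lessThan_atLeast0\<close>)
    moreover have "bij_betw p {..<n} {..<n} \<longleftrightarrow> bij_betw (nth xs) {..<n} {..<n}"
      by (rule bij_betw_cong) (simp add: p_def)
    ultimately show ?thesis by (simp add: tour_def p_def)
  qed
  ultimately show "H \<in> tour_edges n ` {p. tour n p}"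
    using xs(2) cycle_edges_tour by (metis image_eqI mem_Collect_eq)
next
  fix H assume "H \<in> tour_edges n ` {p. tour n p}"
  then show "H \<in> ham_cycles n"
    using is_ham_order_tour cycle_edges_tour unfolding ham_cycles_def by blast
qed

section \<open>2-opt moves\<close>

lemma tour_rev_seg:
  assumes "tour n p" "1 \<le> lo" "hi < n"
  shows "tour n (rev_seg lo hi p)"
proof -
  define \<rho> where "\<rho> k = (if lo \<le> k \<and> k \<le> hi then lo + hi - k else k)" for k
  have "bij_betw \<rho> {..<n} {..<n}"
    by (rule bij_betw_byWitness[where f'=\<rho>]) (use assms in \<open>auto simp: \<rho>_def\<close>)
  then have "bij_betw (p \<circ> \<rho>) {..<n} {..<n}"
    using assms(1) by (auto simp: tour_def intro: bij_betw_trans)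
  moreover have "rev_seg lo hi p = p \<circ> \<rho>"
    by (auto simp: rev_seg_def \<rho>_def)
  \<comment> \<open>The bounds on \<open>lo\<close> and \<open>hi\<close> keep the positions 0 and
    \<open>n\<close> fixed, so the new order is still closed.\<close>
  moreover have "\<rho> n = n" "\<rho> 0 = 0"
    using assms by (auto simp: \<rho>_def)
  ultimately show ?thesis
    using assms(1) by (simp add: tour_def)
qed

lemma sum_split_two:
  fixes f :: "nat \<Rightarrow> nat"
  assumes "i < j" "j < n"
  shows "(\<Sum>k<n. f k) = (\<Sum>k<i. f k) + f i + (\<Sum>k=Suc i..<j. f k) + f j + (\<Sum>k=Suc j..<n. f k)"
proof -
  have "(\<Sum>k<n. f k) = (\<Sum>k=0..<i. f k) + (\<Sum>k=i..<j. f k) + (\<Sum>k=j..<n. f k)"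
    using assms by (simp add: sum.atLeastLessThan_concat lessThan_atLeast0)
  then show ?thesis
    using assms by (simp add: sum.atLeast_Suc_lessThan lessThan_atLeast0)
qed

text \<open>Only the edges at positions \<open>i\<close> and \<open>j\<close> change. Edges outside
  the segment stay in place, and the one inside at position \<open>k\<close> of the new tour is the
  old edge at \<open>i + j - k\<close> traversed backwards, at the same cost by symmetry.\<close>

lemma tour_cost_rev_seg:
  assumes "improving n w p i j" "i < j" "j < n"
  shows "tour_cost n w (rev_seg (Suc i) j p) < tour_cost n w p"
proof -
  let ?q = "rev_seg (Suc i) j p"
  let ?f = "\<lambda>k. ecost n w (p k) (p (Suc k))" and ?g = "\<lambda>k. ecost n w (?q k) (?q (Suc k))"
  have 1: "(\<Sum>k<i. ?g k) = (\<Sum>k<i. ?f k)"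
    by (intro sum.cong) (auto simp: rev_seg_def)
  have 2: "(\<Sum>k=Suc j..<n. ?g k) = (\<Sum>k=Suc j..<n. ?f k)"
    by (intro sum.cong) (auto simp: rev_seg_def)
  have 3: "(\<Sum>k=Suc i..<j. ?g k) = (\<Sum>k=Suc i..<j. ?f k)"
  proof (rule sum.reindex_bij_witness[where i="\<lambda>k. i + j - k" and j="\<lambda>k. i + j - k"])
    fix k assume k: "k \<in> {Suc i..<j}"
    then have "?q k = p (Suc (i + j - k))" "?q (Suc k) = p (i + j - k)"
      by (auto simp: rev_seg_def Suc_diff_le)
    then show "?f (i + j - k) = ?g k" by (simp add: ecost_sym)
  qed auto
  have 4: "?g i = ecost n w (p i) (p j)" "?g j = ecost n w (p (Suc i)) (p (Suc j))"
    using assms by (auto simp: rev_seg_def)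
  show ?thesis
    using assms(1) unfolding tour_cost_def improving_def
      sum_split_two[OF assms(2,3), of ?f] sum_split_two[OF assms(2,3), of ?g] 1 2 3 4
    by simp
qed

lemma wm_le_1:
  assumes "zero_one_instance n w" "u < n" "v < n"
  shows "wm w u v \<le> 1"
proof (cases "u = v")
  case False
  then have "{u, v} \<in> edges_Kn n" using assms by (auto simp: edges_Kn_def)
  then show ?thesis using assms(1) False by (auto simp: zero_one_instance_def wm_def)
qed (simp add: wm_def)

lemma deg_le:
  assumes "zero_one_instance n w" "u < n"
  shows "deg n w u \<le> n"
  using sum_bounded_above[of "{..<n}" "wm w u" 1] wm_le_1[OF assms] by (simp add: deg_def)

lemma tour_cost_le:
  assumes "zero_one_instance n w" "tour n p"
  shows "tour_cost n w p \<le> 2 * n * n"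
proof -
  have "ecost n w (p k) (p (Suc k)) \<le> 2 * n" if "k \<in> {..<n}" for k
    using deg_le[OF assms(1), of "p k"] deg_le[OF assms(1), of "p (Suc k)"]
      tour_lt[OF assms(2), of k] tour_lt[OF assms(2), of "Suc k"] that
    by (auto simp: ecost_def)
  then have "(\<Sum>k<n. ecost n w (p k) (p (Suc k))) \<le> of_nat (card {..<n}) * (2 * n)"
    by (rule sum_bounded_above)
  then show ?thesis
    by (simp add: tour_cost_def mult.commute mult.left_commute)
qed

section \<open>Heavy and saturated vertices\<close>

definition heavy :: "nat \<Rightarrow> (nat set \<Rightarrow> nat) \<Rightarrow> nat set" where
  "heavy n w = {x. x < n \<and> n - 1 \<le> 2 * deg n w x}"

text \<open>The vertex itself is excluded explicitly, since \<open>wm\<close> vanishes on the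
  diagonal.\<close>

definition light_nbrs :: "nat \<Rightarrow> (nat set \<Rightarrow> nat) \<Rightarrow> nat \<Rightarrow> nat set" where
  "light_nbrs n w x = {y. y < n \<and> y \<noteq> x \<and> wm w x y = 0}"

definition saturated :: "nat \<Rightarrow> (nat set \<Rightarrow> nat) \<Rightarrow> nat set" where
  "saturated n w = {x \<in> heavy n w. card (light_nbrs n w x) \<le> card (heavy n w)}"

lemma finite_heavy [simp]: "finite (heavy n w)"
  by (rule finite_subset[of _ "{..<n}"]) (auto simp: heavy_def)

lemma finite_light_nbrs [simp]: "finite (light_nbrs n w x)"
  by (rule finite_subset[of _ "{..<n}"]) (auto simp: light_nbrs_def)

lemma saturated_subset: "saturated n w \<subseteq> heavy n w" "saturated n w \<subseteq> {..<n}"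
  by (auto simp: saturated_def heavy_def)

lemma two_optimal_ineq:
  assumes "two_optimal n w p" "i < n" "j < n" "i \<noteq> j"
  shows "ecost n w (p i) (p (Suc i)) + ecost n w (p j) (p (Suc j))
     \<le> ecost n w (p i) (p j) + ecost n w (p (Suc i)) (p (Suc j))"
proof (cases "i < j")
  case True
  then show ?thesis using assms by (auto simp: two_optimal_def improving_def not_less)
next
  case False
  then have "\<not> improving n w p j i" using assms by (auto simp: two_optimal_def)
  then show ?thesis
    by (simp add: improving_def not_less ecost_sym[of n w "p j" "p i"]
        ecost_sym[of n w "p (Suc j)" "p (Suc i)"] add.commute)
qed

lemma ecost_le: "ecost n w u v \<le> deg n w u + deg n w v"
  by (simp add: ecost_def)

text \<open>Pigeonhole on positions: more than \<open>card (heavy n w)\<close> of them carry a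
  weight-0 neighbour of \<open>x\<close> under \<open>q\<close>, at most that many a heavy vertex
  under \<open>q'\<close>. The two maps will be the tour and its shift, in either order, to serve
  both ends of an edge.\<close>

lemma escape_nbr:
  assumes "bij_betw q {..<n} {..<n}" "bij_betw q' {..<n} {..<n}"
    and "x \<in> heavy n w - saturated n w"
  obtains j where "j < n" "q j \<in> light_nbrs n w x" "q' j \<notin> heavy n w"
proof -
  let ?J = "{j\<in>{..<n}. q j \<in> light_nbrs n w x}" and ?K = "{j\<in>{..<n}. q' j \<in> heavy n w}"
  have "light_nbrs n w x \<subseteq> q ` {..<n}"
    using assms(1) by (auto simp: bij_betw_def light_nbrs_def)
  then have "light_nbrs n w x \<subseteq> q ` ?J" by auto
  then have "card (light_nbrs n w x) \<le> card ?J"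
    by (intro surj_card_le) auto
  moreover have "card ?K \<le> card (heavy n w)"
    using assms(2) by (intro card_inj_on_le[of q']) (auto simp: bij_betw_def inj_on_def)
  ultimately have "\<not> ?J \<subseteq> ?K"
    using assms(3) card_mono[of ?K ?J] by (auto simp: saturated_def)
  then show ?thesis using that by auto
qed

lemma two_optimal_edge:
  assumes "zero_one_instance n w" "tour n p" "two_optimal n w p" "2 \<le> n" "i < n"
    and "wm w (p i) (p (Suc i)) \<noteq> 0"
  shows "p i \<in> saturated n w \<or> p (Suc i) \<in> saturated n w"
proof (rule ccontr)
  assume neg: "\<not> ?thesis"
  have bij: "bij_betw p {..<n} {..<n}" "bij_betw (\<lambda>k. p (Suc k)) {..<n} {..<n}"
    using assms tour_Suc_bij by (auto simp: tour_def)
  have lt: "p i < n" "p (Suc i) < n" using tour_lt assms by auto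
  note c = assms(6)
  have e: "ecost n w (p i) (p (Suc i)) = deg n w (p i) + deg n w (p (Suc i))"
    using c by (simp add: ecost_def)
  show False
  proof (cases "p i \<in> heavy n w \<or> p (Suc i) \<in> heavy n w")
    case True
    then show False
    proof
      assume h: "p i \<in> heavy n w"
      then obtain j where j: "j < n" "p j \<in> light_nbrs n w (p i)" "p (Suc j) \<notin> heavy n w"
        using escape_nbr[OF bij, of "p i"] neg by blast
      then have "i \<noteq> j" "ecost n w (p i) (p j) = 0"
        by (auto simp: light_nbrs_def ecost_def)
      \<comment> \<open>The move removes at least the degrees of \<open>p i\<close> and
        \<open>p (Suc i)\<close> and inserts at most those of \<open>p (Suc i)\<close> and
        \<open>p (Suc j)\<close>, so this inequality makes it profitable.\<close>
      moreover have "deg n w (p (Suc j)) < deg n w (p i)"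
        using h j tour_lt[OF assms(2), of "Suc j"] by (auto simp: heavy_def)
      ultimately show False
        using two_optimal_ineq[OF assms(3,5) j(1)] e ecost_le[of n w "p (Suc i)" "p (Suc j)"] by auto
    next
      \<comment> \<open>Mirror image: predecessors on the tour take the place of successors.\<close>
      assume h: "p (Suc i) \<in> heavy n w"
      then obtain j where j: "j < n" "p (Suc j) \<in> light_nbrs n w (p (Suc i))" "p j \<notin> heavy n w"
        using escape_nbr[OF bij(2,1), of "p (Suc i)"] neg by blast
      then have "i \<noteq> j" "ecost n w (p (Suc i)) (p (Suc j)) = 0"
        by (auto simp: light_nbrs_def ecost_def)
      moreover have "deg n w (p j) < deg n w (p (Suc i))"
        using h j tour_lt[OF assms(2), of j] by (auto simp: heavy_def)
      ultimately show False
        using two_optimal_ineq[OF assms(3,5) j(1)] e ecost_le[of n w "p i" "p j"] by auto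
    qed
  next
    case False
    have count: "card {j\<in>{..<n}. wm w x (q j) \<noteq> 0} = deg n w x"
      if q: "bij_betw q {..<n} {..<n}" and x: "x < n" for q x
    proof -
      have "deg n w x = (\<Sum>j<n. wm w x (q j))"
        unfolding deg_def by (rule sum.reindex_bij_betw[OF q, symmetric])
      also have "\<dots> = (\<Sum>j<n. if wm w x (q j) \<noteq> 0 then 1 else 0)"
      proof (rule sum.cong[OF refl])
        fix j assume "j \<in> {..<n}"
        then have "q j < n" using q bij_betwE by blast
        then show "wm w x (q j) = (if wm w x (q j) \<noteq> 0 then 1 else 0)"
          using wm_le_1[OF assms(1) x, of "q j"] by auto
      qed
      finally show ?thesis by (simp add: sum.If_cases Int_def)
    qed
    \<comment> \<open>\<open>?J\<close> and \<open>?K\<close> collect the positions for which the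
      first or the second inserted edge has weight 1.\<close>
    let ?J = "{j\<in>{..<n}. wm w (p i) (p j) \<noteq> 0}"
    let ?K = "{j\<in>{..<n}. wm w (p (Suc i)) (p (Suc j)) \<noteq> 0}"
    \<comment> \<open>Position \<open>i\<close> lies in neither set, because \<open>wm\<close> is 0
      on the diagonal, but it is no legal partner of itself and has to be excluded by hand.\<close>
    have "card (insert i (?J \<union> ?K)) \<le> 1 + (card ?J + card ?K)"
      using card_Un_le[of ?J ?K] by (simp add: card_insert_if)
    also have "\<dots> < n"
      using count[OF bij(1) lt(1)] count[OF bij(2) lt(2)] False lt by (auto simp: heavy_def)
    finally have "\<not> {..<n} \<subseteq> insert i (?J \<union> ?K)"
      using card_mono[of "insert i (?J \<union> ?K)" "{..<n}"] by auto
    then obtain j where j: "j < n" "i \<noteq> j" "wm w (p i) (p j) = 0" "wm w (p (Suc i)) (p (Suc j)) = 0"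
      by auto
    \<comment> \<open>The edge itself counts towards the degree, so its removal saves a positive
      amount.\<close>
    have "wm w (p i) (p (Suc i)) \<le> deg n w (p i)"
      unfolding deg_def using lt by (intro member_le_sum) auto
    then show False
      using two_optimal_ineq[OF assms(3,5) j(1,2)] e j c by (simp add: ecost_def)
  qed
qed

section \<open>Tour weight and saturated vertices\<close>

lemma sum_indicator_bij:
  fixes n :: nat and q :: "nat \<Rightarrow> nat"
  assumes "bij_betw q {..<n} {..<n}" "A \<subseteq> {..<n}"
  shows "(\<Sum>k<n. of_bool (q k \<in> A)) = card A"
proof -
  have "(\<Sum>k<n. of_bool (q k \<in> A)) = (\<Sum>k<n. of_bool (k \<in> A) :: nat)"
    by (rule sum.reindex_bij_betw[OF assms(1)])
  also have "\<dots> = card A"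
    using assms(2) by (simp add: Int_absorb1)
  finally show ?thesis .
qed

text \<open>Every vertex is the first end of exactly one tour edge and the second end of exactly
  one.\<close>

lemma sum_indicator_tour:
  assumes "tour n p" "0 < n" "A \<subseteq> {..<n}"
  shows "(\<Sum>k<n. of_bool (p k \<in> A) + of_bool (p (Suc k) \<in> A)) = 2 * card A"
  using sum_indicator_bij[OF _ assms(3), of p] sum_indicator_bij[OF _ assms(3), of "\<lambda>k. p (Suc k)"]
    tour_Suc_bij[OF assms(1,2)] assms(1)
  by (simp add: sum.distrib tour_def)

lemma two_optimal_wt:
  assumes "zero_one_instance n w" "tour n p" "two_optimal n w p" "3 \<le> n"
  shows "wt w (tour_edges n p) \<le> 2 * card (saturated n w)"
proof -
  have "wm w (p k) (p (Suc k))
      \<le> of_bool (p k \<in> saturated n w) + of_bool (p (Suc k) \<in> saturated n w)" if "k \<in> {..<n}" for k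
    using two_optimal_edge[OF assms(1-3), of k] wm_le_1[OF assms(1), of "p k" "p (Suc k)"]
      tour_lt[OF assms(2)] assms(4) that by (cases "wm w (p k) (p (Suc k)) = 0") auto
  then have "(\<Sum>k<n. wm w (p k) (p (Suc k)))
      \<le> (\<Sum>k<n. of_bool (p k \<in> saturated n w) + of_bool (p (Suc k) \<in> saturated n w))"
    by (rule sum_mono)
  then show ?thesis
    using wt_tour[OF assms(2,4)] sum_indicator_tour[OF assms(2) _ saturated_subset(2)] assms(4) by simp
qed

definition exceptional :: "nat \<Rightarrow> (nat set \<Rightarrow> nat) \<Rightarrow> nat set set" where
  "exceptional n w = (\<Union>x\<in>saturated n w. (\<lambda>y. {x, y}) ` (light_nbrs n w x \<union> (saturated n w - {x})))"

text \<open>A tour edge that is not exceptional has at most one saturated end, and if it has one,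
  its weight is positive. So the weight dominates the number of saturated ends edge by edge.\<close>

lemma tour_avoiding_exceptional:
  assumes "zero_one_instance n w" "tour n p" "3 \<le> n" "tour_edges n p \<inter> exceptional n w = {}"
  shows "2 * card (saturated n w) \<le> wt w (tour_edges n p)"
proof -
  have "of_bool (p k \<in> saturated n w) + of_bool (p (Suc k) \<in> saturated n w)
      \<le> wm w (p k) (p (Suc k))" if k: "k \<in> {..<n}" for k
  proof -
    have e: "{p k, p (Suc k)} \<notin> exceptional n w" "{p (Suc k), p k} \<notin> exceptional n w"
      using assms(4) k by (auto simp: tour_edges_def insert_commute)
    have ne: "p k \<noteq> p (Suc k)" "p (Suc k) \<noteq> p k" using tour_neq_Suc[OF assms(2), of k] assms(3) k by auto
    have lt: "p k < n" "p (Suc k) < n" using tour_lt[OF assms(2)] k by auto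
    have s: "p (Suc k) \<notin> light_nbrs n w (p k)" "p (Suc k) \<notin> saturated n w" if "p k \<in> saturated n w"
      using e(1) that ne unfolding exceptional_def by blast+
    have t: "p k \<notin> light_nbrs n w (p (Suc k))" "p k \<notin> saturated n w" if "p (Suc k) \<in> saturated n w"
      using e(2) that ne unfolding exceptional_def by blast+
    show ?thesis
      using s t lt ne wm_sym[of w "p k" "p (Suc k)"] by (auto simp: light_nbrs_def)
  qed
  then have "(\<Sum>k<n. of_bool (p k \<in> saturated n w) + of_bool (p (Suc k) \<in> saturated n w))
      \<le> (\<Sum>k<n. wm w (p k) (p (Suc k)))"
    by (rule sum_mono)
  then show ?thesis
    using wt_tour[OF assms(2,3)] sum_indicator_tour[OF assms(2) _ saturated_subset(2)] assms(3) by simp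
qed

text \<open>With \<open>h\<close> heavy vertices, a saturated vertex has at most \<open>h\<close>
  weight-0 edges by definition and at most \<open>h\<close> edges to other saturated vertices, which
  are all heavy.\<close>

lemma card_exceptional: "card (exceptional n w) \<le> 2 * (card (heavy n w))\<^sup>2"
proof -
  let ?h = "card (heavy n w)" and ?S = "saturated n w"
  have fin: "finite ?S" using saturated_subset(2) finite_subset by blast
  have S: "card ?S \<le> ?h" by (intro card_mono) (auto simp: saturated_subset)
  have "card (exceptional n w) \<le> (\<Sum>x\<in>?S. card ((\<lambda>y. {x, y}) ` (light_nbrs n w x \<union> (?S - {x}))))"
    unfolding exceptional_def using fin by (intro card_UN_le)
  also have "\<dots> \<le> (\<Sum>x\<in>?S. 2 * ?h)"
  proof (rule sum_mono)
    fix x assume x: "x \<in> ?S"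
    have "card ((\<lambda>y. {x, y}) ` (light_nbrs n w x \<union> (?S - {x}))) \<le> card (light_nbrs n w x \<union> (?S - {x}))"
      using fin by (intro card_image_le) auto
    also have "\<dots> \<le> card (light_nbrs n w x) + card (?S - {x})" by (rule card_Un_le)
    also have "\<dots> \<le> ?h + ?h"
      using x S card_Diff1_le[of ?S x] by (intro add_mono) (auto simp: saturated_def)
    finally show "card ((\<lambda>y. {x, y}) ` (light_nbrs n w x \<union> (?S - {x}))) \<le> 2 * ?h" by simp
  qed
  also have "\<dots> \<le> ?h * (2 * ?h)" using S by simp
  finally show ?thesis by (simp add: power2_eq_square)
qed

lemma exceptional_subset: "exceptional n w \<subseteq> edges_Kn n"
proof
  fix e assume "e \<in> exceptional n w"
  then obtain x y where "e = {x, y}" "x < n" "y < n" "x \<noteq> y"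
    using saturated_subset(2)[of n w] unfolding exceptional_def light_nbrs_def by auto
  then show "e \<in> edges_Kn n" by (auto simp: edges_Kn_def)
qed

section \<open>Hamilton cycles through a given edge\<close>

lemma edges_Kn_subsets: "edges_Kn n = {e. e \<subseteq> {..<n} \<and> card e = 2}"
  by (auto simp: edges_Kn_def card_2_iff)

lemma finite_edges_Kn [simp]: "finite (edges_Kn n)"
  by (rule finite_subset[of _ "Pow {..<n}"]) (auto simp: edges_Kn_subsets)

lemma card_edges_Kn: "card (edges_Kn n) = n choose 2"
  using n_subsets[of "{..<n}" 2] by (simp add: edges_Kn_subsets)

lemma tour_edges_subset:
  assumes "tour n p" "2 \<le> n"
  shows "tour_edges n p \<subseteq> edges_Kn n"
proof
  fix e assume "e \<in> tour_edges n p"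
  then obtain k where "k < n" "e = {p k, p (Suc k)}" by (auto simp: tour_edges_def)
  then show "e \<in> edges_Kn n"
    using tour_neq_Suc[OF assms, of k] tour_lt[OF assms(1), of k] tour_lt[OF assms(1), of "Suc k"]
    by (auto simp: edges_Kn_def)
qed

lemma finite_ham_cycles [simp]:
  assumes "2 \<le> n"
  shows "finite (ham_cycles n)"
  by (rule finite_subset[of _ "Pow (edges_Kn n)"])
     (use assms tour_edges_subset in \<open>auto simp: ham_cycles_tour\<close>)

lemma tour_comp:
  assumes "tour n p" "bij_betw \<pi> {..<n} {..<n}"
  shows "tour n (\<pi> \<circ> p)" "tour_edges n (\<pi> \<circ> p) = (`) \<pi> ` tour_edges n p"
  using assms by (auto simp: tour_def tour_edges_def image_image intro: bij_betw_trans)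

text \<open>Two transpositions: the first sends \<open>i\<close> to \<open>i'\<close>, the second
  corrects the image of \<open>j\<close> and leaves \<open>i'\<close> alone. Bijectivity on all
  naturals will make the induced map on edge sets injective.\<close>

lemma move_edge:
  assumes "i < n" "j < n" "i \<noteq> j" "i' < n" "j' < n" "i' \<noteq> j'"
  obtains \<pi> :: "nat \<Rightarrow> nat" where "bij \<pi>" "bij_betw \<pi> {..<n} {..<n}" "\<pi> i = i'" "\<pi> j = j'"
proof -
  define \<sigma> where "\<sigma> = transpose i i'"
  define \<tau> where "\<tau> = transpose (\<sigma> j) j'"
  have lt: "\<sigma> j < n" using assms by (auto simp: \<sigma>_def transpose_def)
  have ne: "\<sigma> j \<noteq> i'" using assms by (auto simp: \<sigma>_def transpose_def)
  have b: "bij_betw \<sigma> {..<n} {..<n}" "bij_betw \<tau> {..<n} {..<n}"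
    using assms lt by (auto simp: \<sigma>_def \<tau>_def transpose_image_eq bij_betw_def)
  show thesis
  proof (rule that[of "\<tau> \<circ> \<sigma>"])
    show "bij (\<tau> \<circ> \<sigma>)" unfolding \<sigma>_def \<tau>_def by (intro bij_comp) auto
    show "bij_betw (\<tau> \<circ> \<sigma>) {..<n} {..<n}" using b bij_betw_trans by blast
  qed (use assms ne in \<open>auto simp: \<sigma>_def \<tau>_def transpose_def\<close>)
qed

text \<open>Relabelling the vertices embeds the cycles through \<open>e\<close> into those through
  \<open>f\<close>; exchanging the roles gives equality.\<close>

lemma card_ham_cycles_edge_le:
  assumes "2 \<le> n" "e \<in> edges_Kn n" "f \<in> edges_Kn n"
  shows "card {H \<in> ham_cycles n. e \<in> H} \<le> card {H \<in> ham_cycles n. f \<in> H}"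
proof -
  obtain i j where e: "i < n" "j < n" "i \<noteq> j" "e = {i, j}" using assms by (auto simp: edges_Kn_def)
  obtain i' j' where f: "i' < n" "j' < n" "i' \<noteq> j'" "f = {i', j'}" using assms by (auto simp: edges_Kn_def)
  obtain \<pi> where \<pi>: "bij \<pi>" "bij_betw \<pi> {..<n} {..<n}" "\<pi> i = i'" "\<pi> j = j'"
    using move_edge e f by metis
  show ?thesis
  proof (rule card_inj_on_le[where f="(`) ((`) \<pi>)"])
    have "inj ((`) ((`) \<pi>))" using \<pi>(1) by (metis bij_is_inj inj_image_eq_iff injI)
    then show "inj_on ((`) ((`) \<pi>)) {H \<in> ham_cycles n. e \<in> H}" by (rule inj_on_subset) simp
    have "\<pi> ` e = f" using e f \<pi> by simp
    then show "(`) ((`) \<pi>) ` {H \<in> ham_cycles n. e \<in> H} \<subseteq> {H \<in> ham_cycles n. f \<in> H}"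
      using tour_comp[OF _ \<pi>(2)] by (fastforce simp: ham_cycles_tour)
    show "finite {H \<in> ham_cycles n. f \<in> H}" using assms(1) by simp
  qed
qed

text \<open>Double counting of pairs of a cycle and an edge on it: each cycle has \<open>n\<close>
  edges, and by symmetry all \<open>n choose 2\<close> edges lie on equally many cycles.\<close>

lemma card_ham_cycles_edge:
  assumes "3 \<le> n" "e \<in> edges_Kn n"
  shows "card {H \<in> ham_cycles n. e \<in> H} * (n - 1) = 2 * card (ham_cycles n)"
proof -
  let ?N = "\<lambda>e. card {H \<in> ham_cycles n. e \<in> H}"
  have const: "?N f = ?N e" if "f \<in> edges_Kn n" for f
    using card_ham_cycles_edge_le[of n] that assms by (intro antisym) auto
  have "n * card (ham_cycles n) = (\<Sum>H\<in>ham_cycles n. card H)"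
  proof -
    have "card H = n" if "H \<in> ham_cycles n" for H
      using that assms tour_edge_inj by (auto simp: ham_cycles_tour tour_edges_def card_image)
    then show ?thesis by simp
  qed
  also have "\<dots> = (\<Sum>H\<in>ham_cycles n. \<Sum>f | f \<in> edges_Kn n \<and> f \<in> H. 1)"
  proof (rule sum.cong[OF refl])
    fix H assume "H \<in> ham_cycles n"
    then have "{f. f \<in> edges_Kn n \<and> f \<in> H} = H"
      using tour_edges_subset[of n] assms(1) by (auto simp: ham_cycles_tour)
    then show "card H = (\<Sum>f | f \<in> edges_Kn n \<and> f \<in> H. 1)" by simp
  qed
  also have "\<dots> = (\<Sum>f\<in>edges_Kn n. \<Sum>H | H \<in> ham_cycles n \<and> f \<in> H. 1)"
    using assms(1) by (intro sum.swap_restrict) auto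
  also have "\<dots> = card (edges_Kn n) * ?N e" using const by simp
  finally have "2 * n * card (ham_cycles n) = 2 * (n choose 2) * ?N e"
    by (simp add: card_edges_Kn)
  also have "2 * (n choose 2) = n * (n - 1)" unfolding choose_two by (rule dvd_mult_div_cancel) auto
  finally show ?thesis using assms(1) by (simp add: mult.commute mult.left_commute)
qed

section \<open>Sparsity and the domination ratio\<close>

lemma sum_deg: "(\<Sum>u<n. deg n w u) = 2 * wt w (edges_Kn n)"
proof -
  have "(\<Sum>u<n. deg n w u) = (\<Sum>u<n. \<Sum>e | e \<in> edges_Kn n \<and> u \<in> e. w e)"
  proof (rule sum.cong[OF refl])
    fix u assume u: "u \<in> {..<n}"
    have "{e. e \<in> edges_Kn n \<and> u \<in> e} = (\<lambda>v. {u, v}) ` ({..<n} - {u})"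
      using u by (auto simp: edges_Kn_def)
    moreover have "inj_on (\<lambda>v. {u, v}) ({..<n} - {u})"
      by (auto simp: inj_on_def doubleton_eq_iff)
    ultimately have "(\<Sum>e | e \<in> edges_Kn n \<and> u \<in> e. w e) = (\<Sum>v\<in>{..<n} - {u}. w {u, v})"
      by (simp add: sum.reindex)
    also have "\<dots> = (\<Sum>v\<in>{..<n} - {u}. wm w u v)"
      by (intro sum.cong) (auto simp: wm_def)
    also have "\<dots> = deg n w u"
      unfolding deg_def by (rule sum.mono_neutral_left) (auto simp: wm_def)
    finally show "deg n w u = (\<Sum>e | e \<in> edges_Kn n \<and> u \<in> e. w e)" by simp
  qed
  also have "\<dots> = (\<Sum>e\<in>edges_Kn n. \<Sum>u | u \<in> {..<n} \<and> u \<in> e. w e)"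
    using sum.swap_restrict[of "{..<n}" "edges_Kn n" "\<lambda>u. w" "\<lambda>u e. u \<in> e"] by simp
  also have "\<dots> = (\<Sum>e\<in>edges_Kn n. 2 * w e)"
  proof (rule sum.cong[OF refl])
    fix e assume "e \<in> edges_Kn n"
    then have "{u. u \<in> {..<n} \<and> u \<in> e} = e" "card e = 2" by (auto simp: edges_Kn_subsets)
    then show "(\<Sum>u | u \<in> {..<n} \<and> u \<in> e. w e) = 2 * w e" by simp
  qed
  finally show ?thesis by (simp add: wt_def sum_distrib_left)
qed

text \<open>Markov's inequality for degrees: \<open>h\<close> heavy vertices give
  \<open>h * (n - 1) \<le> 4 * wt w (edges_Kn n)\<close>, and the right side is
  \<open>2 * d * n * (n - 1)\<close>. Hence \<open>h \<le> 2 * d * n\<close>, and the bound on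
  \<open>d\<close> finishes.\<close>

lemma card_heavy_le:
  assumes "sparse_instance n d \<epsilon> w" "2 \<le> n"
  shows "2 * real (card (heavy n w)) \<le> real n powr (1/2 - \<epsilon>)"
proof -
  let ?h = "card (heavy n w)"
  have "?h * (n - 1) = (\<Sum>u\<in>heavy n w. n - 1)" by simp
  also have "\<dots> \<le> (\<Sum>u\<in>heavy n w. 2 * deg n w u)"
    by (intro sum_mono) (auto simp: heavy_def)
  also have "\<dots> \<le> (\<Sum>u<n. 2 * deg n w u)"
    by (intro sum_mono2) (auto simp: heavy_def)
  also have "\<dots> = 4 * wt w (edges_Kn n)" by (simp add: sum_distrib_left[symmetric] sum_deg)
  finally have "real (?h * (n - 1)) \<le> real (4 * wt w (edges_Kn n))" by (rule of_nat_mono)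
  then have "real ?h * (real n - 1) \<le> 4 * real (wt w (edges_Kn n))"
    using assms(2) by (simp add: of_nat_diff)
  also have "\<dots> = 4 * (d * real (n choose 2))" using assms(1) by (simp add: sparse_instance_def)
  also have "real (n choose 2) = real n * (real n - 1) / 2"
    using assms(2) by (simp add: choose_two real_of_nat_div of_nat_diff)
  also have "4 * (d * (real n * (real n - 1) / 2)) = 2 * (d * real n) * (real n - 1)" by simp
  finally have "real ?h \<le> 2 * (d * real n)" using assms(2) by (simp add: mult_le_cancel_right)
  also have "d * real n \<le> 1/4 * real n powr (- 1/2 - \<epsilon>) * real n"
    using assms(1) by (intro mult_right_mono) (auto simp: sparse_instance_def)
  also have "\<dots> = 1/4 * (real n powr (- 1/2 - \<epsilon>) * real n powr 1)" using assms(2) by simp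
  also have "real n powr (- 1/2 - \<epsilon>) * real n powr 1 = real n powr (1/2 - \<epsilon>)"
    by (subst powr_add[symmetric]) (simp add: algebra_simps)
  finally show ?thesis by simp
qed

theorem two_optimal_domination:
  assumes "sparse_instance n d \<epsilon> w" "3 \<le> n" "tour n p" "two_optimal n w p"
  shows "domination_ratio_ge n w (tour_edges n p) (1 - 6 * real n powr (- 2 * \<epsilon>))"
proof -
  let ?h = "card (heavy n w)" and ?F = "exceptional n w" and ?T = "card (ham_cycles n)"
  let ?B = "{H \<in> ham_cycles n. wt w H < wt w (tour_edges n p)}"
  have zo: "zero_one_instance n w" using assms(1) by (simp add: sparse_instance_def)
  have fin: "finite ?F" using exceptional_subset finite_subset finite_edges_Kn by metis
  \<comment> \<open>A cycle cheaper than the tour weighs less than twice the number of saturated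
    vertices, so it uses an exceptional edge. A union bound follows.\<close>
  have "?B \<subseteq> (\<Union>e\<in>?F. {H \<in> ham_cycles n. e \<in> H})"
  proof
    fix H assume H: "H \<in> ?B"
    then obtain q where q: "tour n q" "H = tour_edges n q" by (auto simp: ham_cycles_tour)
    then have "H \<inter> ?F \<noteq> {}"
      using H two_optimal_wt[OF zo assms(3,4,2)] tour_avoiding_exceptional[OF zo q(1) assms(2)] by auto
    then show "H \<in> (\<Union>e\<in>?F. {H \<in> ham_cycles n. e \<in> H})" using H by auto
  qed
  then have "card ?B \<le> card (\<Union>e\<in>?F. {H \<in> ham_cycles n. e \<in> H})"
    using fin assms(2) by (intro card_mono) auto
  also have "\<dots> \<le> (\<Sum>e\<in>?F. card {H \<in> ham_cycles n. e \<in> H})"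
    using fin by (rule card_UN_le)
  finally have "card ?B * (n - 1) \<le> (\<Sum>e\<in>?F. card {H \<in> ham_cycles n. e \<in> H} * (n - 1))"
    by (simp add: sum_distrib_right[symmetric])
  also have "\<dots> = (\<Sum>e\<in>?F. 2 * ?T)"
    using card_ham_cycles_edge[OF assms(2)] exceptional_subset by (intro sum.cong) auto
  also have "\<dots> \<le> 2 * ?h\<^sup>2 * (2 * ?T)"
    using card_exceptional[of n w] by simp
  finally have "real (card ?B * (n - 1)) \<le> real (2 * ?h\<^sup>2 * (2 * ?T))" by (rule of_nat_mono)
  then have 1: "real (card ?B) * (real n - 1) \<le> (2 * real ?h)\<^sup>2 * real ?T"
    using assms(2) by (simp add: of_nat_diff power2_eq_square)
  have "(2 * real ?h)\<^sup>2 \<le> (real n powr (1/2 - \<epsilon>))\<^sup>2"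
    using card_heavy_le[OF assms(1)] assms(2) by (intro power_mono) auto
  also have "\<dots> = real n powr (1 + (- 2 * \<epsilon>))"
    by (simp add: power2_eq_square powr_add[symmetric])
  also have "\<dots> = real n * real n powr (- 2 * \<epsilon>)"
    using assms(2) by (subst powr_add) simp
  \<comment> \<open>The union bound leaves a factor \<open>n / (n - 1)\<close>, which the constant 6
    absorbs.\<close>
  also have "\<dots> \<le> (6 * (real n - 1)) * real n powr (- 2 * \<epsilon>)"
    using assms(2) by (intro mult_right_mono) auto
  finally have "(2 * real ?h)\<^sup>2 * real ?T \<le> (6 * (real n - 1)) * real n powr (- 2 * \<epsilon>) * real ?T"
    by (rule mult_right_mono) simp
  with 1 have "real (card ?B) * (real n - 1) \<le> (6 * real n powr (- 2 * \<epsilon>) * real ?T) * (real n - 1)"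
    by (simp add: algebra_simps)
  then have "real (card ?B) \<le> 6 * real n powr (- 2 * \<epsilon>) * real ?T"
    using assms(2) by (simp add: mult_le_cancel_right)
  \<comment> \<open>The case \<open>?T = 0\<close> is settled by the convention that division by 0
    gives 0.\<close>
  then have "real (card ?B) / real ?T \<le> 6 * real n powr (- 2 * \<epsilon>)"
    by (cases "?T = 0") (simp_all add: divide_le_eq)
  then show ?thesis by (simp add: domination_ratio_ge_def)
qed

section \<open>The RAM program\<close>

text \<open>Memory layout: the input occupies the addresses \<open>0..n\<^sup>2\<close>; behind it come the start
  addresses of the matrix rows, the degrees, and the tour \<open>p 0, \<dots>, p n\<close> with \<open>p n = p 0\<close>.\<close>
definition env :: "nat \<Rightarrow> (nat \<Rightarrow> nat) \<Rightarrow> bool" where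
  "env n r \<longleftrightarrow> r 30 = 1 \<and> r 2 = n \<and> r 3 = n * n + 1 \<and> r 4 = n * n + 1 + n \<and> r 5 = n * n + 1 + n + n"

text \<open>Stored row starts replace multiplication: adding \<open>v\<close> to the entry for
  \<open>u\<close> gives the address of the matrix entry.\<close>

definition tables :: "nat \<Rightarrow> (nat set \<Rightarrow> nat) \<Rightarrow> (nat \<Rightarrow> nat) \<Rightarrow> bool" where
  "tables n w m \<longleftrightarrow> (\<forall>u<n. m (n * n + 1 + u) = 1 + u * n \<and> m (n * n + 1 + n + u) = deg n w u \<and>
     (\<forall>v<n. m (1 + u * n + v) = wm w u v))"

definition tour_of :: "nat \<Rightarrow> (nat \<Rightarrow> nat) \<Rightarrow> nat \<Rightarrow> nat" where
  "tour_of n m k = m (n * n + 1 + n + n + k)"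

text \<open>Register conventions: 30 holds the constant 1; 2 to 5 hold \<open>n\<close> and the
  region bases; 9 and 10 are counters, 21 is a loop guard; 6 flags a found move and 7, 8 delimit its
  segment; 11 to 14 hold vertices, 15 to 18 costs; 19 and 20 are scratch.\<close>

definition square_loop :: com where
  "square_loop = Loop [Sub 21 2 9] 21 (Blk [Add 3 3 2, Add 9 9 30])"

definition degree_loop :: com where
  "degree_loop = Loop [Sub 21 2 10] 21 (Blk [Load 20 22, Add 23 23 20, Add 22 22 30, Add 10 10 30])"

text \<open>Register 22 runs through the whole matrix and enters each round as the start of the
  current row. The round also writes the identity into the tour; the closing entry 0 is memory left
  untouched.\<close>

definition table_loop :: com where
  "table_loop = Loop [Sub 21 2 9] 21
     (Seq (Blk [Add 19 3 9, Store 19 22, LoadC 23 0, LoadC 10 0])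
     (Seq degree_loop
          (Blk [Add 19 4 9, Store 19 23, Add 19 5 9, Store 19 9, Add 9 9 30])))"

definition lookup :: "nat \<Rightarrow> nat \<Rightarrow> nat \<Rightarrow> com" where
  "lookup x u v = Seq (Blk [Add 19 3 u, Load 20 19, Add 20 20 v, Load x 20])
     (If x (Blk [Add 19 4 u, Load 20 19, Add 19 4 v, Load x 19, Add x x 20]))"

text \<open>Truncated subtraction leaves register 15 nonzero exactly for a profitable move. Register
  10 is copied by adding a zero from register 19. A hit does not end the search; a later one
  overwrites it.\<close>

definition test_pair :: com where
  "test_pair =
     Seq (Blk [Add 19 5 9, Load 11 19, Add 19 19 30, Load 12 19,
               Add 19 5 10, Load 13 19, Add 19 19 30, Load 14 19])
    (Seq (lookup 15 11 12)
    (Seq (lookup 16 13 14)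
    (Seq (lookup 17 11 13)
    (Seq (lookup 18 12 14)
    (Seq (Blk [Add 15 15 16, Add 17 17 18, Sub 15 15 17])
    (Seq (If 15 (Blk [LoadC 6 1, Add 7 9 30, LoadC 19 0, Add 8 10 19]))
         (Blk [Add 10 10 30])))))))"

definition search_row :: com where
  "search_row = Loop [Sub 21 2 10] 21 test_pair"

definition search :: com where
  "search = Loop [Sub 21 2 9] 21 (Seq (Blk [Add 10 9 30]) (Seq search_row (Blk [Add 9 9 30])))"

definition reverse_loop :: com where
  "reverse_loop = Loop [Sub 21 8 7] 21
     (Blk [Add 19 5 7, Add 20 5 8, Load 25 19, Load 26 20, Store 19 26, Store 20 25,
           Add 7 7 30, Sub 8 8 30])"

text \<open>Register 6 is both loop guard and search flag. The reversal runs even after a failed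
  search, then on the trivial segment from 0 to 0.\<close>

definition optimise :: com where
  "optimise = Loop [] 6
     (Seq (Blk [LoadC 6 0, LoadC 7 0, LoadC 8 0, LoadC 9 0]) (Seq search reverse_loop))"

text \<open>The output overwrites the start of the input; \<open>n\<close> survives in register 2,
  and the tour lies beyond the overwritten cells.\<close>

definition copy_loop :: com where
  "copy_loop = Loop [Sub 21 2 9] 21 (Blk [Add 19 5 9, Load 20 19, Store 9 20, Add 9 9 30])"

definition two_opt :: com where
  "two_opt =
     Seq (Blk [LoadC 30 1, Load 2 0, LoadC 3 1])
    (Seq square_loop
    (Seq (Blk [Add 4 3 2, Add 5 4 2, LoadC 9 0, LoadC 22 1])
    (Seq table_loop
    (Seq (Blk [LoadC 6 1])
    (Seq optimise
    (Seq (Blk [LoadC 9 0])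
         copy_loop))))))"

lemmas program_defs = two_opt_def square_loop_def table_loop_def degree_loop_def optimise_def
  search_def search_row_def test_pair_def lookup_def reverse_loop_def copy_loop_def

lemma wf_two_opt: "wf_com two_opt"
  by (simp add: program_defs)

section \<open>Correctness and running time of the loops\<close>

lemma runs_square_loop:
  assumes "r 30 = 1" "r 2 = n" "r 3 = 1" "r 9 = 0"
  shows "runs square_loop (r, m) (5 * n + 2)
    (\<lambda>s. snd s = m \<and> fst s 30 = 1 \<and> fst s 2 = n \<and> fst s 3 = n * n + 1)"
  unfolding square_loop_def
proof (rule runs_Loop[where k=n and B=2 and I="\<lambda>k s. snd s = m \<and> fst s 30 = 1 \<and> fst s 2 = n \<and>
      fst s 3 = fst s 9 * n + 1 \<and> fst s 9 \<le> n \<and> k = n - fst s 9"])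
  fix k :: nat and s :: store
  assume "snd s = m \<and> fst s 30 = 1 \<and> fst s 2 = n \<and>
      fst s 3 = fst s 9 * n + 1 \<and> fst s 9 \<le> n \<and> k = n - fst s 9"
    and "fst (blk [Sub 21 2 9] s) 21 \<noteq> 0"
  then show "runs (Blk [Add 3 3 2, Add 9 9 30]) (blk [Sub 21 2 9] s) 2
     (\<lambda>s'. \<exists>k'<k. snd s' = m \<and> fst s' 30 = 1 \<and> fst s' 2 = n \<and>
      fst s' 3 = fst s' 9 * n + 1 \<and> fst s' 9 \<le> n \<and> k' = n - fst s' 9)"
    by (cases s) (intro runs_Blk; simp)
qed (use assms in \<open>auto split: prod.splits\<close>)

lemma runs_degree_loop:
  assumes "env n r" "r 9 = i" "r 10 = 0" "r 23 = 0" "r 22 = 1 + i * n"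
    and "\<And>v. v < n \<Longrightarrow> m (1 + i * n + v) = wm w i v"
  shows "runs degree_loop (r, m) (7 * n + 2)
    (\<lambda>s. snd s = m \<and> env n (fst s) \<and> fst s 9 = i \<and> fst s 22 = 1 + Suc i * n \<and> fst s 23 = deg n w i)"
  unfolding degree_loop_def
proof (rule runs_Loop[where k=n and B=4 and I="\<lambda>k s. snd s = m \<and> env n (fst s) \<and> fst s 9 = i \<and>
      fst s 22 = 1 + i * n + fst s 10 \<and> fst s 23 = (\<Sum>v<fst s 10. wm w i v) \<and> fst s 10 \<le> n \<and>
      k = n - fst s 10"])
  fix k :: nat and s :: store
  assume "snd s = m \<and> env n (fst s) \<and> fst s 9 = i \<and>
      fst s 22 = 1 + i * n + fst s 10 \<and> fst s 23 = (\<Sum>v<fst s 10. wm w i v) \<and> fst s 10 \<le> n \<and>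
      k = n - fst s 10"
    and "fst (blk [Sub 21 2 10] s) 21 \<noteq> 0"
  then show "runs (Blk [Load 20 22, Add 23 23 20, Add 22 22 30, Add 10 10 30]) (blk [Sub 21 2 10] s) 4
     (\<lambda>s'. \<exists>k'<k. snd s' = m \<and> env n (fst s') \<and> fst s' 9 = i \<and>
      fst s' 22 = 1 + i * n + fst s' 10 \<and> fst s' 23 = (\<Sum>v<fst s' 10. wm w i v) \<and> fst s' 10 \<le> n \<and>
      k' = n - fst s' 10)"
    using assms(6) by (cases s) (intro runs_Blk; simp add: env_def)
qed (use assms in \<open>auto simp: env_def deg_def split: prod.splits\<close>)

lemma runs_table_loop:
  assumes "env n r" "r 9 = 0" "r 22 = 1"
    and mat: "\<And>u v. u < n \<Longrightarrow> v < n \<Longrightarrow> m (1 + u * n + v) = wm w u v"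
    and last: "tour_of n m n = 0"
  shows "runs table_loop (r, m) (n * (7 * n + 14) + 2)
    (\<lambda>s. env n (fst s) \<and> tables n w (snd s) \<and> (\<forall>k<n. tour_of n (snd s) k = k) \<and> tour_of n (snd s) n = 0)"
proof -
  define I where "I k s \<longleftrightarrow> env n (fst s) \<and> fst s 9 \<le> n \<and> fst s 22 = 1 + fst s 9 * n \<and> k = n - fst s 9 \<and>
    (\<forall>u<fst s 9. snd s (n * n + 1 + u) = 1 + u * n \<and> snd s (n * n + 1 + n + u) = deg n w u
       \<and> tour_of n (snd s) u = u) \<and> (\<forall>a\<le>n * n. snd s a = m a) \<and> tour_of n (snd s) n = 0"
    for k :: nat and s :: store
  \<comment> \<open>The matrix ends at address \<open>n * n\<close>, just before the first table
    cell, so filling the tables leaves it intact.\<close>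
  have cell: "1 + u * n + v \<le> n * n" if "u < n" "v < n" for u v
  proof -
    have "Suc u * n \<le> n * n" using that by (intro mult_right_mono) auto
    then show ?thesis using that by simp
  qed
  show ?thesis
    unfolding table_loop_def
  proof (rule runs_Loop[where k=n and B="7 * n + 11" and I=I])
    show "I n (r, m)" using assms by (simp add: I_def)
  next
    fix k s assume I: "I k s" and "fst (blk [Sub 21 2 9] s) 21 = 0"
    then have 9: "fst s 9 = n" by (cases s) (auto simp: I_def env_def)
    have "tables n w (snd s)"
      using I 9 mat cell by (auto simp: tables_def I_def)
    then show "env n (fst (blk [Sub 21 2 9] s)) \<and> tables n w (snd (blk [Sub 21 2 9] s)) \<and>
        (\<forall>k<n. tour_of n (snd (blk [Sub 21 2 9] s)) k = k) \<and> tour_of n (snd (blk [Sub 21 2 9] s)) n = 0"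
      using I 9 by (cases s) (auto simp: I_def env_def)
  next
    fix k s assume I: "I k s" and "fst (blk [Sub 21 2 9] s) 21 \<noteq> 0"
    obtain r1 m1 where s: "s = (r1, m1)" by (cases s)
    define i where "i = r1 9"
    have i: "i < n" using I \<open>fst _ 21 \<noteq> 0\<close> s by (auto simp: I_def env_def i_def)
    define m2 where "m2 = m1(n * n + 1 + i := 1 + i * n)"
    show "runs (Seq (Blk [Add 19 3 9, Store 19 22, LoadC 23 0, LoadC 10 0])
       (Seq degree_loop (Blk [Add 19 4 9, Store 19 23, Add 19 5 9, Store 19 9, Add 9 9 30])))
       (blk [Sub 21 2 9] s) (7 * n + 11) (\<lambda>s'. \<exists>k'<k. I k' s')"
    proof (rule runs_Seq[where ?B1.0=4 and ?B2.0="7 * n + 7" and ?Q1.0="\<lambda>s. snd s = m2 \<and> env n (fst s) \<and>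
        fst s 9 = i \<and> fst s 10 = 0 \<and> fst s 23 = 0 \<and> fst s 22 = 1 + i * n"])
      show "runs (Blk [Add 19 3 9, Store 19 22, LoadC 23 0, LoadC 10 0]) (blk [Sub 21 2 9] s) 4
        (\<lambda>s. snd s = m2 \<and> env n (fst s) \<and> fst s 9 = i \<and> fst s 10 = 0 \<and> fst s 23 = 0 \<and> fst s 22 = 1 + i * n)"
        using I s by (intro runs_Blk) (auto simp: I_def env_def i_def m2_def)
    next
      fix s1 assume s1: "snd s1 = m2 \<and> env n (fst s1) \<and> fst s1 9 = i \<and> fst s1 10 = 0 \<and> fst s1 23 = 0
        \<and> fst s1 22 = 1 + i * n"
      show "runs (Seq degree_loop (Blk [Add 19 4 9, Store 19 23, Add 19 5 9, Store 19 9, Add 9 9 30]))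
        s1 (7 * n + 7) (\<lambda>s'. \<exists>k'<k. I k' s')"
      proof (rule runs_Seq)
        have "m2 (1 + i * n + v) = wm w i v" if "v < n" for v
          using cell[OF i that] mat[OF i that] I s by (auto simp: m2_def I_def)
        then show "runs degree_loop s1 (7 * n + 2) (\<lambda>s. snd s = m2 \<and> env n (fst s) \<and> fst s 9 = i \<and>
            fst s 22 = 1 + Suc i * n \<and> fst s 23 = deg n w i)"
          using runs_degree_loop[of n "fst s1" i m2 w] s1 by (cases s1) simp
      next
        fix s2 assume s2: "snd s2 = m2 \<and> env n (fst s2) \<and> fst s2 9 = i \<and>
            fst s2 22 = 1 + Suc i * n \<and> fst s2 23 = deg n w i"
        obtain r2 where r2: "s2 = (r2, m2)" using s2 by (cases s2) auto
        have k: "k = n - i" using I s by (simp add: I_def i_def)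
        let ?s = "blk [Add 19 4 9, Store 19 23, Add 19 5 9, Store 19 9, Add 9 9 30] s2"
        have m3: "snd ?s = m2(n * n + 1 + n + i := deg n w i, n * n + 1 + n + n + i := i)"
          and r3: "env n (fst ?s)" "fst ?s 9 = Suc i" "fst ?s 22 = 1 + Suc i * n"
          using s2 r2 by (auto simp: env_def)
        have "I (n - Suc i) ?s"
          unfolding I_def r3(2,3) m3 using r3(1) I s i
          by (auto simp: I_def tour_of_def m2_def i_def less_Suc_eq)
        then show "runs (Blk [Add 19 4 9, Store 19 23, Add 19 5 9, Store 19 9, Add 9 9 30]) s2 5
            (\<lambda>s'. \<exists>k'<k. I k' s')"
          using k i by (intro runs_Blk) (auto intro!: exI[of _ "n - Suc i"])
      qed simp
    qed simp
  qed (simp add: algebra_simps)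
qed

text \<open>The ranges keep \<open>x\<close>, \<open>u\<close>, \<open>v\<close> away from the
  scratch and address registers; the final scratch contents are left open as \<open>a\<close> and
  \<open>b\<close>.\<close>

lemma runs_lookup:
  assumes "env n r" "tables n w m" "r u < n" "r v < n"
    and "x \<in> {11..18}" "u \<in> {11..18}" "v \<in> {11..18}" "x \<noteq> u" "x \<noteq> v"
  shows "runs (lookup x u v) (r, m) 10
    (\<lambda>s. \<exists>a b. s = (r(19 := a, 20 := b, x := ecost n w (r u) (r v)), m))"
proof -
  have t: "m (n * n + 1 + r u) = 1 + r u * n" "m (n * n + 1 + n + r u) = deg n w (r u)"
    "m (n * n + 1 + n + r v) = deg n w (r v)" "m (1 + r u * n + r v) = wm w (r u) (r v)"
    using assms(2-4) by (auto simp: tables_def)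
  have ne: "x \<noteq> 19" "x \<noteq> 20" "u \<noteq> 19" "u \<noteq> 20" "v \<noteq> 19" "v \<noteq> 20" "x \<noteq> 3" "x \<noteq> 4"
    using assms(5-7) by auto
  have e: "r 3 = n * n + 1" "r 4 = n * n + 1 + n" using assms(1) by (auto simp: env_def)
  let ?r = "r(19 := n * n + 1 + r u, 20 := 1 + r u * n + r v, x := wm w (r u) (r v))"
  show ?thesis
    unfolding lookup_def
  proof (rule runs_Seq[where ?B1.0=4 and ?B2.0=6 and ?Q1.0="\<lambda>s. s = (?r, m)"])
    show "runs (Blk [Add 19 3 u, Load 20 19, Add 20 20 v, Load x 20]) (r, m) 4 (\<lambda>s. s = (?r, m))"
      using t(1,4) ne assms(8,9) by (intro runs_Blk) (simp_all add: e)
  next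
    fix s assume s: "s = (?r, m)"
    show "runs (If x (Blk [Add 19 4 u, Load 20 19, Add 19 4 v, Load x 19, Add x x 20])) s 6
      (\<lambda>s. \<exists>a b. s = (r(19 := a, 20 := b, x := ecost n w (r u) (r v)), m))"
    proof (rule runs_If[where B=5])
      assume "fst s x = 0"
      then have "ecost n w (r u) (r v) = wm w (r u) (r v)" using s by (simp add: ecost_def)
      then show "\<exists>a b. s = (r(19 := a, 20 := b, x := ecost n w (r u) (r v)), m)" using s by auto
    next
      assume nz: "fst s x \<noteq> 0"
      have "blk [Add 19 4 u, Load 20 19, Add 19 4 v, Load x 19, Add x x 20] s
        = (r(19 := n * n + 1 + n + r v, 20 := deg n w (r u), x := ecost n w (r u) (r v)), m)"
        using t(2,3) ne assms(8,9) nz by (auto simp: s e ecost_def fun_upd_def)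
      then show "runs (Blk [Add 19 4 u, Load 20 19, Add 19 4 v, Load x 19, Add x x 20]) s 5
        (\<lambda>s. \<exists>a b. s = (r(19 := a, 20 := b, x := ecost n w (r u) (r v)), m))"
        by (intro runs_Blk) auto
    qed simp
  qed simp
qed

lemma runs_test_pair:
  assumes "env n r" "tables n w m" "tour n (tour_of n m)" "r 9 = i" "r 10 = j" "i < j" "j < n"
  shows "runs test_pair (r, m) 60 (\<lambda>s. \<exists>r'. s = (r', m) \<and> env n r' \<and> r' 9 = i \<and> r' 10 = Suc j \<and>
    (if improving n w (tour_of n m) i j then r' 6 = 1 \<and> r' 7 = Suc i \<and> r' 8 = j
     else r' 6 = r 6 \<and> r' 7 = r 7 \<and> r' 8 = r 8))"
proof -
  let ?p = "tour_of n m" and ?c = "ecost n w"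
  define keep where "keep r' \<longleftrightarrow> env n r' \<and> r' 9 = i \<and> r' 10 = j \<and> r' 11 = ?p i \<and> r' 12 = ?p (Suc i) \<and>
    r' 13 = ?p j \<and> r' 14 = ?p (Suc j) \<and> r' 6 = r 6 \<and> r' 7 = r 7 \<and> r' 8 = r 8" for r'
  have lt: "?p i < n" "?p (Suc i) < n" "?p j < n" "?p (Suc j) < n"
    using tour_lt[OF assms(3)] assms(6,7) by auto
  have keep_upd: "keep (r'(19 := a, 20 := b, x := c))" if "keep r'" "x \<in> {15..18}" for r' a b c x
    using that by (auto simp: keep_def env_def)
  \<comment> \<open>Each lookup preserves \<open>keep\<close> and the costs already held in the
    other registers from 15 to 18.\<close>
  have look: "runs (lookup x u v) (r', m) 10 (\<lambda>s. \<exists>r''. s = (r'', m) \<and> keep r'' \<and>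
      r'' x = ?c (r' u) (r' v) \<and> (\<forall>y\<in>{15..18} - {x}. r'' y = r' y))"
    if "keep r'" "x \<in> {15..18}" "u \<in> {11..14}" "v \<in> {11..14}" for r' x u v
  proof (rule runs_mono)
    have "u = 11 \<or> u = 12 \<or> u = 13 \<or> u = 14" "v = 11 \<or> v = 12 \<or> v = 13 \<or> v = 14"
      using that by auto
    then have "r' u < n" "r' v < n" using that(1) lt by (auto simp: keep_def)
    then show "runs (lookup x u v) (r', m) 10
        (\<lambda>s. \<exists>a b. s = (r'(19 := a, 20 := b, x := ?c (r' u) (r' v)), m))"
      using that assms(2) by (intro runs_lookup) (auto simp: keep_def)
  next
    fix s assume "\<exists>a b. s = (r'(19 := a, 20 := b, x := ?c (r' u) (r' v)), m)"
    then show "\<exists>r''. s = (r'', m) \<and> keep r'' \<and> r'' x = ?c (r' u) (r' v) \<and>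
        (\<forall>y\<in>{15..18} - {x}. r'' y = r' y)"
      using keep_upd[OF that(1,2)] by fastforce
  qed simp
  show ?thesis
    unfolding test_pair_def
  proof (rule runs_Seq[where ?B1.0=8 and ?B2.0=52 and ?Q1.0="\<lambda>s. \<exists>r'. s = (r', m) \<and> keep r'"], goal_cases)
    case 1
    show ?case
      using assms by (intro runs_Blk) (auto simp: keep_def env_def tour_of_def)
  next
    case (2 s)
    then obtain r1 where r1: "s = (r1, m)" "keep r1" by blast
    show ?case unfolding r1(1)
    proof (rule runs_Seq[where ?B2.0=42, OF look[OF r1(2)]], goal_cases)
      case (4 s)
      then obtain r2 where r2: "s = (r2, m)" "keep r2" "r2 15 = ?c (?p i) (?p (Suc i))"
        using r1(2) by (auto simp: keep_def)
      show ?case unfolding r2(1)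
      proof (rule runs_Seq[where ?B2.0=32, OF look[OF r2(2)]], goal_cases)
        case (4 s)
        then obtain r3 where r3: "s = (r3, m)" "keep r3" "r3 15 = r2 15"
            "r3 16 = ?c (?p j) (?p (Suc j))"
          using r2(2) by (auto simp: keep_def)
        show ?case unfolding r3(1)
        proof (rule runs_Seq[where ?B2.0=22, OF look[OF r3(2)]], goal_cases)
          case (4 s)
          then obtain r4 where r4: "s = (r4, m)" "keep r4" "r4 15 = r3 15" "r4 16 = r3 16"
              "r4 17 = ?c (?p i) (?p j)"
            using r3(2) by (auto simp: keep_def)
          show ?case unfolding r4(1)
          proof (rule runs_Seq[where ?B2.0=12, OF look[OF r4(2)]], goal_cases)
            case (4 s)
            then obtain r5 where r5: "s = (r5, m)" "keep r5" "r5 15 = r4 15" "r5 16 = r4 16"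
                "r5 17 = r4 17" "r5 18 = ?c (?p (Suc i)) (?p (Suc j))"
              using r4(2) by (auto simp: keep_def)
            show ?case unfolding r5(1)
            \<comment> \<open>Register 15 now holds the truncated difference of old and new
              cost.\<close>
            proof (rule runs_Seq[where ?B1.0=3 and ?B2.0=9 and ?Q1.0="\<lambda>s. \<exists>r'. s = (r', m) \<and> keep r' \<and>
                (r' 15 \<noteq> 0 \<longleftrightarrow> improving n w ?p i j)"], goal_cases)
              case 1
              show ?case
                using r5 r4 r3 r2 by (intro runs_Blk) (auto simp: keep_def env_def improving_def)
            next
              case (2 s)
              then obtain r6 where r6: "s = (r6, m)" "keep r6" "r6 15 \<noteq> 0 \<longleftrightarrow> improving n w ?p i j"
                by blast
              show ?case
              proof (rule runs_Seq[where ?B1.0=5 and ?B2.0=1 and ?Q1.0="\<lambda>s. \<exists>r'. s = (r', m) \<and> env n r' \<and>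
                  r' 9 = i \<and> r' 10 = j \<and>
                  (if improving n w ?p i j then r' 6 = 1 \<and> r' 7 = Suc i \<and> r' 8 = j
                   else r' 6 = r 6 \<and> r' 7 = r 7 \<and> r' 8 = r 8)"], goal_cases)
                case 1
                show ?case
                  using r6 by (intro runs_If[where B=4] runs_Blk) (auto simp: keep_def env_def)
              next
                case (2 s)
                then show ?case
                  by (elim exE conjE) (intro runs_Blk; simp add: env_def)
              qed simp
            qed simp
          qed simp_all
        qed simp_all
      qed simp_all
    qed simp_all
  qed simp
qed

text \<open>State of the search after testing the pairs in \<open>seen\<close>: either none
  improves, and the zeros denote a trivial segment, or some improving pair is stored as the segment
  to be reversed.\<close>

definition found :: "nat \<Rightarrow> (nat set \<Rightarrow> nat) \<Rightarrow> (nat \<Rightarrow> nat) \<Rightarrow> (nat \<Rightarrow> nat \<Rightarrow> bool) \<Rightarrow> (nat \<Rightarrow> nat) \<Rightarrow> bool" where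
  "found n w p seen r \<longleftrightarrow>
     r 6 = 0 \<and> r 7 = 0 \<and> r 8 = 0 \<and> (\<forall>a b. seen a b \<longrightarrow> a < b \<longrightarrow> b < n \<longrightarrow> \<not> improving n w p a b) \<or>
     r 6 = 1 \<and> (\<exists>a b. a < b \<and> b < n \<and> improving n w p a b \<and> r 7 = Suc a \<and> r 8 = b)"

text \<open>Lets \<open>seen\<close> be redescribed, comparing only at pairs
  \<open>a < b < n\<close>, and lets registers other than 6, 7, 8 change.\<close>

lemma found_mono:
  assumes "found n w p seen r" "\<And>a b. seen' a b \<Longrightarrow> a < b \<Longrightarrow> b < n \<Longrightarrow> seen a b"
    and "r' 6 = r 6" "r' 7 = r 7" "r' 8 = r 8"
  shows "found n w p seen' r'"
  using assms unfolding found_def by metis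

lemma runs_search_row:
  assumes "env n r" "tables n w m" "tour n (tour_of n m)" "r 9 = i" "r 10 = Suc i" "i < n"
    and "found n w (tour_of n m) (\<lambda>a b. a < i) r"
  shows "runs search_row (r, m) (63 * n + 2) (\<lambda>s. \<exists>r'. s = (r', m) \<and> env n r' \<and> r' 9 = i \<and>
    found n w (tour_of n m) (\<lambda>a b. a < Suc i) r')"
proof -
  let ?p = "tour_of n m"
  \<comment> \<open>Pairs are tested in lexicographic order: all earlier rows, and row
    \<open>i\<close> up to the counter.\<close>
  define I where "I k s \<longleftrightarrow> (\<exists>r'. s = (r', m) \<and> env n r' \<and> r' 9 = i \<and> i < r' 10 \<and> r' 10 \<le> n \<and>
    k = n - r' 10 \<and> found n w ?p (\<lambda>a b. a < i \<or> a = i \<and> b < r' 10) r')" for k :: nat and s :: store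
  show ?thesis
    unfolding search_row_def
  proof (rule runs_Loop[where k="n - Suc i" and B=60 and I=I])
    show "I (n - Suc i) (r, m)"
      using assms unfolding I_def by (auto intro!: found_mono[OF assms(7)])
  next
    fix k s assume "I k s" "fst (blk [Sub 21 2 10] s) 21 = 0"
    then obtain r' where r': "s = (r', m)" "env n r'" "r' 9 = i" "r' 10 = n"
        "found n w ?p (\<lambda>a b. a < i \<or> a = i \<and> b < r' 10) r'"
      unfolding I_def by (auto simp: env_def)
    have "found n w ?p (\<lambda>a b. a < Suc i) (r'(21 := 0))"
      by (rule found_mono[OF r'(5)]) (use r'(4) in auto)
    then show "\<exists>r'. blk [Sub 21 2 10] s = (r', m) \<and> env n r' \<and> r' 9 = i \<and>
        found n w ?p (\<lambda>a b. a < Suc i) r'"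
      using r' by (auto simp: env_def)
  next
    fix k s assume "I k s" "fst (blk [Sub 21 2 10] s) 21 \<noteq> 0"
    then obtain r' where r': "s = (r', m)" "env n r'" "r' 9 = i" "i < r' 10" "r' 10 < n" "k = n - r' 10"
        "found n w ?p (\<lambda>a b. a < i \<or> a = i \<and> b < r' 10) r'"
      unfolding I_def by (auto simp: env_def)
    let ?j = "r' 10" and ?r = "r'(21 := n - r' 10)"
    have s': "blk [Sub 21 2 10] s = (?r, m)" using r' by (auto simp: env_def)
    show "runs test_pair (blk [Sub 21 2 10] s) 60 (\<lambda>s'. \<exists>k'<k. I k' s')"
      unfolding s'
    proof (rule runs_mono[OF runs_test_pair[where n=n and w=w and i=i and j="?j"]])
      fix s2 assume "\<exists>r2. s2 = (r2, m) \<and> env n r2 \<and> r2 9 = i \<and> r2 10 = Suc ?j \<and>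
        (if improving n w ?p i ?j then r2 6 = 1 \<and> r2 7 = Suc i \<and> r2 8 = ?j
         else r2 6 = ?r 6 \<and> r2 7 = ?r 7 \<and> r2 8 = ?r 8)"
      then obtain r2 where r2: "s2 = (r2, m)" "env n r2" "r2 9 = i" "r2 10 = Suc ?j"
        and c: "if improving n w ?p i ?j then r2 6 = 1 \<and> r2 7 = Suc i \<and> r2 8 = ?j
         else r2 6 = ?r 6 \<and> r2 7 = ?r 7 \<and> r2 8 = ?r 8" by blast
      have "found n w ?p (\<lambda>a b. a < i \<or> a = i \<and> b < Suc ?j) r2"
      proof (cases "improving n w ?p i ?j")
        case True
        then show ?thesis using c r' unfolding found_def by auto
      next
        case False
        then show ?thesis using c r'(7) unfolding found_def by (auto simp: less_Suc_eq)
      qed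
      then have "I (n - Suc ?j) s2" using r2 r' by (auto simp: I_def)
      then show "\<exists>k'<k. I k' s2" using r' by (intro exI[of _ "n - Suc ?j"]) auto
    qed (use assms r' in \<open>auto simp: env_def\<close>)
  qed (use assms in \<open>auto simp: algebra_simps\<close>)
qed

lemma runs_search:
  assumes "env n r" "tables n w m" "tour n (tour_of n m)" "r 9 = 0"
    and "r 6 = 0" "r 7 = 0" "r 8 = 0"
  shows "runs search (r, m) (n * (63 * n + 7) + 2) (\<lambda>s. \<exists>r'. s = (r', m) \<and> env n r' \<and>
    found n w (tour_of n m) (\<lambda>a b. True) r')"
proof -
  let ?p = "tour_of n m"
  define I where "I k s \<longleftrightarrow> (\<exists>r'. s = (r', m) \<and> env n r' \<and> r' 9 \<le> n \<and> k = n - r' 9 \<and>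
    found n w ?p (\<lambda>a b. a < r' 9) r')" for k :: nat and s :: store
  show ?thesis
    unfolding search_def
  proof (rule runs_Loop[where k=n and B="63 * n + 4" and I=I])
    show "I n (r, m)" using assms by (auto simp: I_def found_def)
  next
    fix k s assume "I k s" "fst (blk [Sub 21 2 9] s) 21 = 0"
    then obtain r' where r': "s = (r', m)" "env n r'" "r' 9 = n" "found n w ?p (\<lambda>a b. a < r' 9) r'"
      unfolding I_def by (auto simp: env_def)
    have "found n w ?p (\<lambda>a b. True) (r'(21 := 0))"
      by (rule found_mono[OF r'(4)]) (use r'(3) in auto)
    then show "\<exists>r'. blk [Sub 21 2 9] s = (r', m) \<and> env n r' \<and> found n w ?p (\<lambda>a b. True) r'"
      using r' by (auto simp: env_def)
  next
    fix k s assume "I k s" "fst (blk [Sub 21 2 9] s) 21 \<noteq> 0"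
    then obtain r' where r': "s = (r', m)" "env n r'" "r' 9 < n" "k = n - r' 9"
        "found n w ?p (\<lambda>a b. a < r' 9) r'"
      unfolding I_def by (auto simp: env_def)
    let ?i = "r' 9"
    let ?r = "r'(21 := n - ?i, 10 := Suc ?i)"
    show "runs (Seq (Blk [Add 10 9 30]) (Seq search_row (Blk [Add 9 9 30])))
        (blk [Sub 21 2 9] s) (63 * n + 4) (\<lambda>s'. \<exists>k'<k. I k' s')"
    proof (rule runs_Seq[where ?B1.0=1 and ?B2.0="63 * n + 3" and ?Q1.0="\<lambda>s. s = (?r, m)"], goal_cases)
      case 1
      show ?case using r' by (intro runs_Blk) (auto simp: env_def)
    next
      case (2 s1)
      have "found n w ?p (\<lambda>a b. a < ?i) ?r"
        by (rule found_mono[OF r'(5)]) auto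
      then have row: "runs search_row (?r, m) (63 * n + 2) (\<lambda>s. \<exists>r'. s = (r', m) \<and> env n r' \<and> r' 9 = ?i \<and>
          found n w ?p (\<lambda>a b. a < Suc ?i) r')"
        using r' assms by (intro runs_search_row) (auto simp: env_def)
      show ?case unfolding 2
      proof (rule runs_Seq[where ?B2.0=1, OF row], goal_cases)
        case (1 s2)
        then obtain r2 where r2: "s2 = (r2, m)" "env n r2" "r2 9 = ?i"
            "found n w ?p (\<lambda>a b. a < Suc ?i) r2" by blast
        have "found n w ?p (\<lambda>a b. a < Suc ?i) (r2(9 := Suc ?i))"
          by (rule found_mono[OF r2(4)]) auto
        then have "I (n - Suc ?i) (blk [Add 9 9 30] s2)"
          using r2 r' by (auto simp: I_def env_def)
        then show ?case using r' by (intro runs_Blk) (auto intro!: exI[of _ "n - Suc ?i"])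
      qed simp
    qed simp
  qed (simp add: algebra_simps)
qed

lemma runs_reverse_loop:
  assumes "env n r" "tables n w m" "r 7 = lo" "r 8 = hi" "lo \<le> hi" "hi < n"
  shows "runs reverse_loop (r, m) (11 * n + 2) (\<lambda>s. env n (fst s) \<and> fst s 6 = r 6 \<and> tables n w (snd s) \<and>
    tour_of n (snd s) = rev_seg lo hi (tour_of n m))"
proof -
  let ?p = "tour_of n m"
  let ?b = "n * n + 1 + n + n"
  \<comment> \<open>Two pointers move inwards with constant sum \<open>lo + hi\<close>, and
    positions outside them are already reversed. For a segment of even length they end up crossed by
    one.\<close>
  define I where "I k s \<longleftrightarrow> env n (fst s) \<and> fst s 6 = r 6 \<and> lo \<le> fst s 7 \<and> fst s 8 \<le> hi \<and>
    fst s 7 + fst s 8 = lo + hi \<and> fst s 7 \<le> Suc (fst s 8) \<and> k = fst s 8 - fst s 7 \<and>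
    (\<forall>a<?b. snd s a = m a) \<and>
    (\<forall>k. tour_of n (snd s) k = (if lo \<le> k \<and> k < fst s 7 \<or> fst s 8 < k \<and> k \<le> hi then ?p (lo + hi - k) else ?p k))"
    for k :: nat and s :: store
  show ?thesis
    unfolding reverse_loop_def
  proof (rule runs_Loop[where k="hi - lo" and B=8 and I=I])
    show "I (hi - lo) (r, m)" using assms by (auto simp: I_def)
  next
    fix k s assume I: "I k s" and "fst (blk [Sub 21 8 7] s) 21 = 0"
    obtain r' m' where s: "s = (r', m')" by (cases s)
    have 8: "r' 8 \<le> r' 7" using \<open>fst _ 21 = 0\<close> by (simp add: s)
    have "tour_of n m' k = rev_seg lo hi ?p k" for k
    \<comment> \<open>A middle position is its own mirror image and was never swapped.\<close>
    proof (cases "k = r' 7 \<and> k = r' 8")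
      case True
      then have "lo + hi - k = k" using I unfolding I_def s fst_conv by linarith
      then show ?thesis using I by (auto simp: I_def s rev_seg_def)
    next
      case False
      then show ?thesis using I 8 by (auto simp: I_def s rev_seg_def)
    qed
    moreover have "tables n w m'"
    proof -
      have "1 + u * n + v < ?b" if "u < n" "v < n" for u v
      proof -
        have "u * n \<le> n * n" using that by simp
        then show ?thesis using that by linarith
      qed
      then show ?thesis using I assms(2) by (auto simp: tables_def I_def s)
    qed
    ultimately show "env n (fst (blk [Sub 21 8 7] s)) \<and> fst (blk [Sub 21 8 7] s) 6 = r 6 \<and>
        tables n w (snd (blk [Sub 21 8 7] s)) \<and> tour_of n (snd (blk [Sub 21 8 7] s)) = rev_seg lo hi ?p"
      using I by (auto simp: s I_def env_def)
  next
    fix k s assume I: "I k s" and "fst (blk [Sub 21 8 7] s) 21 \<noteq> 0"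
    obtain r' m' where s: "s = (r', m')" by (cases s)
    have lt: "r' 7 < r' 8" using \<open>fst _ 21 \<noteq> 0\<close> by (simp add: s)
    let ?l = "r' 7" and ?h = "r' 8"
    let ?s = "blk [Add 19 5 7, Add 20 5 8, Load 25 19, Load 26 20, Store 19 26, Store 20 25,
        Add 7 7 30, Sub 8 8 30] (blk [Sub 21 8 7] s)"
    have m3: "snd ?s = m'(?b + ?l := tour_of n m' ?h, ?b + ?h := tour_of n m' ?l)"
      and r3: "env n (fst ?s)" "fst ?s 6 = r 6" "fst ?s 7 = Suc ?l" "fst ?s 8 = ?h - 1"
      using I by (auto simp: s I_def env_def tour_of_def)
    have t: "tour_of n (snd ?s) = (tour_of n m')(?l := tour_of n m' ?h, ?h := tour_of n m' ?l)"
      unfolding m3 by (auto simp: tour_of_def)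
    have p': "tour_of n m' k = (if lo \<le> k \<and> k < ?l \<or> ?h < k \<and> k \<le> hi then ?p (lo + hi - k) else ?p k)" for k
      using I by (simp add: I_def s)
    have sum: "?l + ?h = lo + hi" "lo \<le> ?l" "?h \<le> hi" using I by (auto simp: I_def s)
    have lh: "lo + hi - ?l = ?h" "lo + hi - ?h = ?l" using sum by auto
    have "tour_of n (snd ?s) k =
        (if lo \<le> k \<and> k < Suc ?l \<or> ?h - 1 < k \<and> k \<le> hi then ?p (lo + hi - k) else ?p k)" for k
    proof -
      consider "k = ?l" | "k = ?h" | "k \<noteq> ?l" "k \<noteq> ?h" by blast
      then show ?thesis
      proof cases
        case 1
        then show ?thesis unfolding t using lt sum lh p'[of ?h] by simp
      next
        case 2
        then show ?thesis unfolding t using lt sum lh p'[of ?l] by simp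
      next
        case 3
        then have "(k < Suc ?l) = (k < ?l)" "(?h - 1 < k) = (?h < k)" using lt by auto
        then show ?thesis unfolding t using 3 p'[of k] by simp
      qed
    qed
    moreover have "\<forall>a<?b. snd ?s a = m a"
      unfolding m3 using I by (auto simp: I_def s)
    ultimately have "I (?h - 1 - Suc ?l) ?s"
      unfolding I_def r3(2-4) using r3(1) lt sum by auto
    moreover have "?h - 1 - Suc ?l < k" using I lt by (auto simp: I_def s)
    ultimately show "runs (Blk [Add 19 5 7, Add 20 5 8, Load 25 19, Load 26 20, Store 19 26, Store 20 25,
        Add 7 7 30, Sub 8 8 30]) (blk [Sub 21 8 7] s) 8 (\<lambda>s'. \<exists>k'<k. I k' s')"
      by (intro runs_Blk) (blast, simp)
  qed (use assms in \<open>auto simp: algebra_simps\<close>)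
qed

lemma runs_optimise:
  assumes "env n r" "tables n w m" "tour n (tour_of n m)" "r 6 = 1" "1 \<le> n"
    and "zero_one_instance n w"
  shows "runs optimise (r, m) (400 * n ^ 4) (\<lambda>s. env n (fst s) \<and>
    tour n (tour_of n (snd s)) \<and> two_optimal n w (tour_of n (snd s)))"
proof -
  \<comment> \<open>While the flag is set, \<open>k\<close> strictly bounds the tour cost and serves
    as variant; once it is cleared, two-optimality takes over.\<close>
  define I where "I k s \<longleftrightarrow> env n (fst s) \<and> tables n w (snd s) \<and> tour n (tour_of n (snd s)) \<and>
    (if fst s 6 = 0 then two_optimal n w (tour_of n (snd s)) else tour_cost n w (tour_of n (snd s)) < k)"
    for k :: nat and s :: store
  have sq: "n \<le> n * n" "1 \<le> n * n" using assms(5) by auto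
  show ?thesis
    unfolding optimise_def
  \<comment> \<open>The initial cost is at most \<open>2 * n * n\<close>, and the invariant asks for
    a strict bound.\<close>
  proof (rule runs_Loop[where k="2 * n * n + 1" and B="4 + (n * (63 * n + 7) + 2 + (11 * n + 2))" and I=I])
    show "I (2 * n * n + 1) (r, m)"
      using assms tour_cost_le[OF assms(6,3)] by (simp add: I_def)
  next
    fix k s assume "I k s" "fst (blk [] s) 6 = 0"
    then show "env n (fst (blk [] s)) \<and> tour n (tour_of n (snd (blk [] s))) \<and>
        two_optimal n w (tour_of n (snd (blk [] s)))"
      by (simp add: I_def)
  next
    fix k s assume I: "I k s" and f: "fst (blk [] s) 6 \<noteq> 0"
    obtain r1 m1 where s: "s = (r1, m1)" by (cases s)
    let ?p = "tour_of n m1" and ?r = "r1(6 := 0, 7 := 0, 8 := 0, 9 := 0)"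
    have I1: "env n r1" "tables n w m1" "tour n ?p" "tour_cost n w ?p < k"
      using I f by (auto simp: I_def s)
    show "runs (Seq (Blk [LoadC 6 0, LoadC 7 0, LoadC 8 0, LoadC 9 0]) (Seq search reverse_loop)) (blk [] s)
        (4 + (n * (63 * n + 7) + 2 + (11 * n + 2))) (\<lambda>s'. \<exists>k'<k. I k' s')"
    proof (rule runs_Seq[where ?B1.0=4 and ?B2.0="n * (63 * n + 7) + 2 + (11 * n + 2)"
          and ?Q1.0="\<lambda>s. s = (?r, m1)"], goal_cases)
      case 1
      show ?case by (rule runs_Blk) (auto simp: s)
    next
      case (2 s1)
      have srch: "runs search (?r, m1) (n * (63 * n + 7) + 2) (\<lambda>s. \<exists>r'. s = (r', m1) \<and> env n r' \<and>
          found n w ?p (\<lambda>a b. True) r')"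
        using I1 by (intro runs_search) (auto simp: env_def)
      show ?case unfolding 2
      proof (rule runs_Seq[where ?B2.0="11 * n + 2", OF srch], goal_cases)
        case (1 s2)
        then obtain r2 where r2: "s2 = (r2, m1)" "env n r2" "found n w ?p (\<lambda>a b. True) r2" by blast
        have b: "r2 7 \<le> r2 8" "r2 8 < n" using r2(3) assms(5) by (auto simp: found_def)
        show ?case unfolding r2(1)
        proof (rule runs_mono[OF runs_reverse_loop[OF r2(2) I1(2) refl refl b]])
          fix s3 assume s3: "env n (fst s3) \<and> fst s3 6 = r2 6 \<and> tables n w (snd s3) \<and>
            tour_of n (snd s3) = rev_seg (r2 7) (r2 8) ?p"
          from r2(3) show "\<exists>k'<k. I k' s3"
            unfolding found_def
          proof (elim disjE conjE exE)
            assume a: "r2 6 = 0" "r2 7 = 0" "r2 8 = 0"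
              "\<forall>a b. True \<longrightarrow> a < b \<longrightarrow> b < n \<longrightarrow> \<not> improving n w ?p a b"
            \<comment> \<open>Reversing the one-element segment from 0 to 0 changes nothing, so the
              tour that failed the search is the one kept.\<close>
            then have "rev_seg (r2 7) (r2 8) ?p = ?p" by (auto simp: rev_seg_def)
            then have "I 0 s3" using s3 a I1 by (simp add: I_def two_optimal_def)
            then show ?thesis using I1(4) by (intro exI[of _ 0]) auto
          next
            fix a b assume a: "r2 6 = 1" "a < b" "b < n" "improving n w ?p a b" "r2 7 = Suc a" "r2 8 = b"
            \<comment> \<open>The old cost strictly bounds the new one and lies below
              \<open>k\<close>, so it is the next value of the variant.\<close>
            then have "I (tour_cost n w ?p) s3"
              using s3 I1 tour_cost_rev_seg[OF a(4,2,3)] tour_rev_seg[OF I1(3), of "Suc a" b]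
              by (simp add: I_def)
            then show ?thesis using I1(4) by blast
          qed
        qed simp
      qed simp
    qed simp
  next
    let ?q = "n * n"
    have "(2 * n * n + 1) * (length [] + 2 + (4 + (n * (63 * n + 7) + 2 + (11 * n + 2)))) + length [] + 1
      = (2 * ?q + 1) * (10 + 63 * ?q + 18 * n) + 1"
      by (simp add: algebra_simps)
    also have "\<dots> \<le> (2 * ?q + ?q) * (10 * ?q + 63 * ?q + 18 * ?q) + ?q * ?q"
      using sq by (intro add_mono mult_mono) auto
    also have "\<dots> = 274 * n ^ 4" by (simp add: power4_eq_xxxx algebra_simps)
    also have "\<dots> \<le> 400 * n ^ 4" by simp
    finally show "(2 * n * n + 1) * (length [] + 2 + (4 + (n * (63 * n + 7) + 2 + (11 * n + 2)))) +
      length [] + 1 \<le> 400 * n ^ 4" .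
  qed
qed

lemma runs_copy_loop:
  assumes "env n r" "r 9 = 0"
  shows "runs copy_loop (r, m) (7 * n + 2) (\<lambda>s. \<forall>k<n. snd s k = tour_of n m k)"
proof -
  define I where "I k s \<longleftrightarrow> env n (fst s) \<and> fst s 9 \<le> n \<and> k = n - fst s 9 \<and>
    (\<forall>k<fst s 9. snd s k = tour_of n m k) \<and> (\<forall>k. tour_of n (snd s) k = tour_of n m k)"
    for k :: nat and s :: store
  show ?thesis
    unfolding copy_loop_def
  proof (rule runs_Loop[where k=n and B=4 and I=I])
    show "I n (r, m)" using assms by (simp add: I_def)
  next
    fix k s assume "I k s" "fst (blk [Sub 21 2 9] s) 21 = 0"
    then show "\<forall>k<n. snd (blk [Sub 21 2 9] s) k = tour_of n m k"
      by (cases s) (auto simp: I_def env_def)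
  next
    fix k s assume I: "I k s" and "fst (blk [Sub 21 2 9] s) 21 \<noteq> 0"
    obtain r1 m1 where s: "s = (r1, m1)" by (cases s)
    have i: "r1 9 < n" using I \<open>fst _ 21 \<noteq> 0\<close> by (auto simp: I_def s env_def)
    let ?s = "blk [Add 19 5 9, Load 20 19, Store 9 20, Add 9 9 30] (blk [Sub 21 2 9] s)"
    have m3: "snd ?s = m1(r1 9 := tour_of n m1 (r1 9))"
      and r3: "env n (fst ?s)" "fst ?s 9 = Suc (r1 9)"
      using I by (auto simp: s I_def env_def tour_of_def)
    have "I (n - Suc (r1 9)) ?s"
      unfolding I_def r3(2) m3 using r3(1) I i by (auto simp: I_def s less_Suc_eq tour_of_def)
    moreover have "n - Suc (r1 9) < k" using I i by (auto simp: I_def s)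
    ultimately show "runs (Blk [Add 19 5 9, Load 20 19, Store 9 20, Add 9 9 30]) (blk [Sub 21 2 9] s) 4
        (\<lambda>s'. \<exists>k'<k. I k' s')"
      by (intro runs_Blk) (blast, simp)
  qed simp
qed

text \<open>The local search takes \<open>400 * n ^ 4\<close> of the budget; the other stages are at
  most quadratic. Each \<open>B2\<close> is what remains for the later stages.\<close>

lemma runs_two_opt:
  assumes "1 \<le> n" "zero_one_instance n w" "m 0 = n"
    and mat: "\<And>u v. u < n \<Longrightarrow> v < n \<Longrightarrow> m (1 + u * n + v) = wm w u v"
    and last: "tour_of n m n = 0"
  shows "runs two_opt ((\<lambda>_. 0), m) (500 * n ^ 4)
    (\<lambda>s. \<exists>p. tour n p \<and> two_optimal n w p \<and> (\<forall>k<n. snd s k = p k))"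
proof -
  have pow: "1 \<le> n ^ 4" "n \<le> n ^ 4" "n * n \<le> n ^ 4"
    using assms(1) power_increasing[of 1 4 n] power_increasing[of 2 4 n] by (auto simp: power2_eq_square)
  show ?thesis
    unfolding two_opt_def
  proof (rule runs_Seq[where ?B1.0=3 and ?B2.0="497 * n ^ 4" and ?Q1.0="\<lambda>s. \<exists>r. s = (r, m) \<and>
        r 30 = 1 \<and> r 2 = n \<and> r 3 = 1 \<and> r 9 = 0"], goal_cases)
    case 1
    show ?case using assms(3) by (intro runs_Blk) auto
  next
    case (2 s)
    then obtain r where r: "s = (r, m)" "r 30 = 1" "r 2 = n" "r 3 = 1" "r 9 = 0" by blast
    show ?case unfolding r(1)
    proof (rule runs_Seq[where ?B2.0="490 * n ^ 4", OF runs_square_loop[OF r(2-5)]], goal_cases)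
      case (1 s1)
      obtain r1 where r1: "s1 = (r1, m)" "r1 30 = 1" "r1 2 = n" "r1 3 = n * n + 1"
        using 1 by (cases s1) auto
      show ?case unfolding r1(1)
      proof (rule runs_Seq[where ?B1.0=4 and ?B2.0="486 * n ^ 4" and ?Q1.0="\<lambda>s. \<exists>r. s = (r, m) \<and>
          env n r \<and> r 9 = 0 \<and> r 22 = 1"], goal_cases)
        case 1
        show ?case using r1 by (intro runs_Blk) (auto simp: env_def)
      next
        case (2 s2)
        then obtain r2 where r2: "s2 = (r2, m)" "env n r2" "r2 9 = 0" "r2 22 = 1" by blast
        show ?case unfolding r2(1)
        proof (rule runs_Seq[where ?B2.0="460 * n ^ 4", OF runs_table_loop[OF r2(2-4) mat last]], goal_cases)
          case (3 s3)
          obtain r3 m3 where s3: "s3 = (r3, m3)" by (cases s3)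
          have t3: "env n r3" "tables n w m3" "\<forall>k<n. tour_of n m3 k = k" "tour_of n m3 n = 0"
            using 3 s3 by auto
          have "bij_betw (tour_of n m3) {..<n} {..<n} \<longleftrightarrow> bij_betw (\<lambda>k. k) {..<n} {..<n}"
            using t3(3) by (intro bij_betw_cong) auto
          then have tour: "tour n (tour_of n m3)"
            using t3(3,4) assms(1) by (auto simp: tour_def bij_betw_def)
          show ?case unfolding s3
          proof (rule runs_Seq[where ?B1.0=1 and ?B2.0="459 * n ^ 4" and ?Q1.0="\<lambda>s. s = (r3(6 := 1), m3)"],
              goal_cases)
            case 1
            show ?case by (intro runs_Blk) auto
          next
            case (2 s4)
            have opt: "runs optimise (r3(6 := 1), m3) (400 * n ^ 4) (\<lambda>s. env n (fst s) \<and>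
                tour n (tour_of n (snd s)) \<and> two_optimal n w (tour_of n (snd s)))"
              using t3 tour assms by (intro runs_optimise) (auto simp: env_def)
            show ?case unfolding 2
            proof (rule runs_Seq[where ?B2.0="59 * n ^ 4", OF opt], goal_cases)
              case (1 s5)
              obtain r5 m5 where s5: "s5 = (r5, m5)" by (cases s5)
              show ?case unfolding s5
              proof (rule runs_Seq[where ?B1.0=1 and ?B2.0="58 * n ^ 4" and ?Q1.0="\<lambda>s. s = (r5(9 := 0), m5)"],
                  goal_cases)
                case 1
                show ?case by (intro runs_Blk) auto
              next
                case (2 s6)
                have "runs copy_loop (r5(9 := 0), m5) (7 * n + 2) (\<lambda>s. \<forall>k<n. snd s k = tour_of n m5 k)"
                  using 1 s5 by (intro runs_copy_loop) (auto simp: env_def)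
                then show ?case unfolding 2
                  by (rule runs_mono) (use 1 s5 pow in auto)
              qed (use pow in simp)
            qed simp
          qed (use pow in simp)
        qed (use pow mat last in \<open>auto simp: algebra_simps\<close>)
      qed (use pow in simp)
    qed (use pow in simp)
  qed (use pow in simp)
qed

section \<open>Input encoding and conclusion\<close>

lemma ram_init_eq:
  obtains m where "ram_init n w = (0, (\<lambda>_. 0), m)" "m 0 = n" "tour_of n m n = 0"
    "\<And>u v. u < n \<Longrightarrow> v < n \<Longrightarrow> m (1 + u * n + v) = wm w u v"
proof
  let ?m = "snd (snd (ram_init n w))"
  show "ram_init n w = (0, (\<lambda>_. 0), ?m)" "?m 0 = n" "tour_of n ?m n = 0"
    by (auto simp: ram_init_def tour_of_def)
  fix u v assume uv: "u < n" "v < n"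
  have "Suc u * n \<le> n * n" using uv by (intro mult_right_mono) auto
  \<comment> \<open>Division by \<open>n\<close> with remainder recovers row and column from the
    address.\<close>
  then have "u * n + v < n * n" "(u * n + v) div n = u" "(u * n + v) mod n = v"
    using uv by auto
  then show "?m (1 + u * n + v) = wm w u v"
    by (simp add: ram_init_def wm_def)
qed

theorem theorem5p13:
  fixes \<epsilon> :: real
  assumes "0 < \<epsilon>" and "\<epsilon> < 1/2"
  shows "\<exists>(P :: instr list) (C :: nat). \<forall>n \<ge> 3. \<forall>w. zero_one_instance n w \<longrightarrow>
           (\<exists>t \<le> C * n ^ 4.
              ram_halted P ((ram_step P ^^ t) (ram_init n w)) \<and>
              is_ham_order n (ram_output n ((ram_step P ^^ t) (ram_init n w))) \<and>
              (\<forall>d. n \<ge> 225 \<and> sparse_instance n d \<epsilon> w \<longrightarrow>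
                 domination_ratio_ge n w
                   (cycle_edges (ram_output n ((ram_step P ^^ t) (ram_init n w))))
                   (1 - 6 * real n powr (- 2 * \<epsilon>))))"
proof (rule exI[of _ "compile 0 two_opt"], rule exI[of _ 500], intro allI impI)
  fix n :: nat and w :: "nat set \<Rightarrow> nat"
  assume n: "3 \<le> n" and zo: "zero_one_instance n w"
  let ?P = "compile 0 two_opt"
  obtain m where m: "ram_init n w = (0, (\<lambda>_. 0), m)" "m 0 = n" "tour_of n m n = 0"
    "\<And>u v. u < n \<Longrightarrow> v < n \<Longrightarrow> m (1 + u * n + v) = wm w u v"
    using ram_init_eq by blast
  have "runs two_opt ((\<lambda>_. 0), m) (500 * n ^ 4)
      (\<lambda>s. \<exists>p. tour n p \<and> two_optimal n w p \<and> (\<forall>k<n. snd s k = p k))"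
    using n zo m by (intro runs_two_opt) auto
  then obtain t s p where t: "big two_opt ((\<lambda>_. 0), m) t s" "t \<le> 500 * n ^ 4"
    and p: "tour n p" "two_optimal n w p" "\<forall>k<n. snd s k = p k"
    unfolding runs_def by blast
  \<comment> \<open>Compiled for address 0, the code is the entire program, so a run that ends
    behind it has halted.\<close>
  have fin: "(ram_step ?P ^^ t) (ram_init n w) = (length ?P, s)"
    using compile_correct[OF t(1) wf_two_opt, of ?P 0] by (simp add: m(1) code_at_def)
  have out: "ram_output n (length ?P, s) = map p [0..<n]"
    using p(3) by (simp add: ram_output_def)
  show "\<exists>t \<le> 500 * n ^ 4.
      ram_halted ?P ((ram_step ?P ^^ t) (ram_init n w)) \<and>
      is_ham_order n (ram_output n ((ram_step ?P ^^ t) (ram_init n w))) \<and>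
      (\<forall>d. n \<ge> 225 \<and> sparse_instance n d \<epsilon> w \<longrightarrow>
         domination_ratio_ge n w
           (cycle_edges (ram_output n ((ram_step ?P ^^ t) (ram_init n w))))
           (1 - 6 * real n powr (- 2 * \<epsilon>)))"
  \<comment> \<open>One run serves every \<open>d\<close>: the program depends on neither
    \<open>d\<close> nor \<open>\<epsilon>\<close>, which enter only the analysis.\<close>
  proof (intro exI conjI allI impI)
    show "t \<le> 500 * n ^ 4" by (rule t(2))
  qed (use two_optimal_domination[OF _ n p(1,2)] is_ham_order_tour[OF p(1)] in
      \<open>auto simp: fin out ram_halted_def cycle_edges_tour[OF p(1)]\<close>)
qed

end
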